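(* Let $D, D'\subset \mathbb C^2$ be normal quasi-circular domains (bounded and containing the origin). Then every biholomorphism $f:D\rightarrow D'$ with $f(0)=0$ is linear, i.e. it is the restriction to $D$ of a $\mathbb C$-linear map $\mathbb C^2\to\mathbb C^2$. In particular, every automorphism $f\in \mathrm{Aut}(D)$ with $f(0)=0$ is linear.
   Context: A domain is a connected open set. A bounded domain $D\subset\mathbb C^2$ containing the origin is called quasi-circular with weight $(m_1,m_2)$ (or $(m_1,m_2)$-circular), where $m_1,m_2$ are positive integers, if $(e^{im_1\theta}z_1,e^{im_2\theta}z_2)\in D$ for all $\theta\in\mathbb R$ and all $(z_1,z_2)\in D$. Interchanging the coordinates if necessary and dividing the weight by its greatest common divisor, one may assume $m_1\le m_2$ and $\gcd(m_1,m_2)=1$; with the weight so normalized, $D$ is called normal if $m_1\geq 2$. The weights of $D$ and $D'$ are not assumed to be equal. $\mathrm{Aut}(D)$ denotes the group of biholomorphic self-maps of $D$. *)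

theory Defs
  imports "HOL-Analysis.Analysis"
begin

abbreviation complex_linear :: "(complex^2 \<Rightarrow> complex^2) \<Rightarrow> bool" where
  "complex_linear \<equiv> Vector_Spaces.linear (*s) (*s)"

text \<open>Holomorphy in two variables: the real Frechet derivative exists at every point and is
  \<open>\<complex>\<close>-linear. The only scalar multiplication built into \<open>has_derivative\<close> is the real one, so
  \<open>\<complex>\<close>-linearity has to be required separately.\<close>

definition holomorphic2_on :: "(complex^2 \<Rightarrow> complex^2) \<Rightarrow> (complex^2) set \<Rightarrow> bool"
    (infixl "holomorphic2'_on" 50) where
  "f holomorphic2_on S \<longleftrightarrow>
     (\<forall>z\<in>S. \<exists>f'. complex_linear f' \<and> (f has_derivative f') (at z within S))"

definition biholomorphism ::
    "(complex^2) set \<Rightarrow> (complex^2) set \<Rightarrow> (complex^2 \<Rightarrow> complex^2) \<Rightarrow> bool" where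
  "biholomorphism D D' f \<longleftrightarrow>
     bij_betw f D D' \<and> f holomorphic2_on D \<and> inv_into D f holomorphic2_on D'"

text \<open>Automorphisms are represented by total functions; their values outside \<open>D\<close> are irrelevant.\<close>

definition Aut :: "(complex^2) set \<Rightarrow> (complex^2 \<Rightarrow> complex^2) set" where
  "Aut D = {f. biholomorphism D D f}"

definition quasi_circular :: "nat \<Rightarrow> nat \<Rightarrow> (complex^2) set \<Rightarrow> bool" where
  "quasi_circular m\<^sub>1 m\<^sub>2 D \<longleftrightarrow>
     0 < m\<^sub>1 \<and> 0 < m\<^sub>2 \<and> open D \<and> connected D \<and> bounded D \<and> 0 \<in> D \<and>
     (\<forall>\<theta>::real. \<forall>z\<in>D. vector [cis (real m\<^sub>1 * \<theta>) * z $ 1, cis (real m\<^sub>2 * \<theta>) * z $ 2] \<in> D)"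

text \<open>Normality refers to the normalized weight: both entries are divided by their greatest common
  divisor and the coordinates are ordered so that the smaller entry comes first. The weight
  \<open>(m\<^sub>1, m\<^sub>2)\<close> itself need be neither coprime nor increasing.\<close>

definition normal_quasi_circular :: "nat \<Rightarrow> nat \<Rightarrow> (complex^2) set \<Rightarrow> bool" where
  "normal_quasi_circular m\<^sub>1 m\<^sub>2 D \<longleftrightarrow>
     quasi_circular m\<^sub>1 m\<^sub>2 D \<and> 2 \<le> min (m\<^sub>1 div gcd m\<^sub>1 m\<^sub>2) (m\<^sub>2 div gcd m\<^sub>1 m\<^sub>2)"

end

theory Submission
  imports Defs "HOL-Complex_Analysis.Conformal_Mappings"
begin

text \<open>
  Why the theorem holds. After division of the weight by its greatest common divisor, \<open>D\<close> is
  invariant under the linear circle action \<open>R(\<theta>) = diag(e^(i k \<theta>), e^(i l \<theta>))\<close> with \<open>k\<close>, \<open>l\<close> coprime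
  and both at least \<open>2\<close>. Then neither weight is a nonnegative integer multiple of the other, so the
  only monomials of weight \<open>k\<close> or \<open>l\<close> are the coordinates themselves: a map that commutes with all
  \<open>R(\<theta>)\<close> is linear (\<open>rotation_equivariant_linear\<close>). By Cartan's uniqueness theorem, an automorphism
  of \<open>D\<close> that fixes the origin is determined by its derivative there. Hence two such automorphisms
  commute as soon as their derivatives do; in particular an automorphism with diagonal derivative
  commutes with \<open>R\<close> and is linear (\<open>diagonal_derivative_linear\<close>).

  Let \<open>R'\<close> be the circle action on \<open>D'\<close>, let \<open>A\<close> be the derivative of \<open>f\<close> at the origin, and put
  \<open>\<phi>(\<tau>) = f\<inverse> R'(\<tau>) f\<close>, an automorphism of \<open>D\<close> with derivative \<open>A\<inverse> R'(\<tau>) A\<close>. It suffices to show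
  that every \<open>\<phi>(\<tau>)\<close> is linear: then \<open>f \<circ> A\<inverse>\<close> commutes with \<open>R'\<close>, so it is linear by the remark on
  weights, now applied to \<open>D'\<close> (\<open>biholomorphism_linear\<close>).

  Linearity of \<open>\<phi>(\<tau>)\<close> (\<open>conjugate_rotations_linear\<close>) rests on the derivatives of the automorphisms
  \<open>R(\<theta>) \<circ> \<phi>(\<tau>)\<close>. They are power-bounded by the Cauchy estimates, because all iterates map into the
  bounded set \<open>D\<close>. Divided by a square root of its determinant, such a derivative has trace
  \<open>2 (cos x cos y + c sin x sin y)\<close>, where \<open>x\<close> and \<open>y\<close> are fixed multiples of \<open>\<theta>\<close> and \<open>\<tau>\<close> and \<open>c\<close>
  depends only on \<open>A\<close>. Power-boundedness at \<open>x = y = \<pi>/2\<close> forces \<open>c\<close> to be real with \<open>\<bar>c\<bar> \<le> 1\<close>.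

  \<^item> If \<open>\<bar>c\<bar> = 1\<close>, then power-boundedness makes that derivative scalar, and all derivatives of the
    \<open>\<phi>(\<tau>)\<close> are diagonal.

  \<^item> If \<open>\<bar>c\<bar> < 1\<close>, the trace vanishes along a curve of parameters. On it the square of the derivative
    is scalar by the Cayley-Hamilton theorem, and the phase of this scalar varies along the curve, so
    it can be chosen not to be a root of unity. The corresponding automorphism \<open>z \<mapsto> \<mu> z\<close> commutes with
    all automorphisms that fix the origin, and comparison of Taylor coefficients along complex lines
    shows that they are all linear (\<open>scalar_equivariant_linear\<close>).

  All estimates on holomorphic maps come from the one-variable Schwarz lemma and Cauchy inequality
  on discs in the domain.
\<close>

section \<open>Holomorphic maps of two variables\<close>

lemma norm_le_sum_components:
  fixes z :: "complex^2"
  shows "norm z \<le> norm (z$1) + norm (z$2)"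
  using L2_set_le_sum[of UNIV "\<lambda>i. norm (z$i)"] by (simp add: norm_vec_def sum_2)

lemma norm_vec_smult: "norm (s *s z) = norm s * norm (z :: complex^'n)"
  by (simp add: norm_vec_def L2_set_def norm_mult power_mult_distrib real_sqrt_mult
      flip: sum_distrib_left)

lemma holomorphic2_onI_at:
  assumes "\<And>z. z \<in> S \<Longrightarrow> \<exists>A. (f has_derivative (\<lambda>v. A *v v)) (at z)"
  shows "f holomorphic2_on S"
  unfolding holomorphic2_on_def
  using assms has_derivative_at_withinI matrix_vector_mul_linear_gen by fastforce

lemma holomorphic2_on_derivative_at:
  assumes "f holomorphic2_on S" "open S" "z \<in> S"
  obtains A where "(f has_derivative (\<lambda>v. A *v v)) (at z)"
proof -
  obtain f' where f': "complex_linear f'" "(f has_derivative f') (at z within S)"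
    using assms unfolding holomorphic2_on_def by blast
  have "f' = (\<lambda>v. matrix f' *v v)"
    using f'(1) by (auto simp: matrix_works)
  then show ?thesis
    using that f'(2) assms at_within_open by metis
qed

lemma holomorphic2_on_subset: "f holomorphic2_on S \<Longrightarrow> T \<subseteq> S \<Longrightarrow> f holomorphic2_on T"
  unfolding holomorphic2_on_def using has_derivative_subset by blast

lemma holomorphic2_on_compose:
  assumes "f holomorphic2_on S" "g holomorphic2_on T" "open S" "open T" "f ` S \<subseteq> T"
  shows "(\<lambda>z. g (f z)) holomorphic2_on S"
proof (rule holomorphic2_onI_at)
  fix z assume z: "z \<in> S"
  obtain A where A: "(f has_derivative (\<lambda>v. A *v v)) (at z)"
    using holomorphic2_on_derivative_at assms z by metis
  obtain B where B: "(g has_derivative (\<lambda>v. B *v v)) (at (f z))"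
    using holomorphic2_on_derivative_at assms z by (metis imageI subsetD)
  show "\<exists>A. ((\<lambda>z. g (f z)) has_derivative (\<lambda>v. A *v v)) (at z)"
    using has_derivative_compose[OF A B] by (auto simp: matrix_vector_mul_assoc)
qed

lemma has_derivative_matrix: "((\<lambda>v. A *v v) has_derivative (\<lambda>v. A *v v)) (at (z :: complex^2))"
  by (rule bounded_linear_imp_has_derivative) (rule matrix_vector_mul_bounded_linear)

lemma holomorphic2_on_matrix: "(\<lambda>v. A *v v) holomorphic2_on S"
  using has_derivative_matrix by (intro holomorphic2_onI_at) blast

lemma holomorphic2_on_diff:
  assumes "f holomorphic2_on S" "g holomorphic2_on S" "open S"
  shows "(\<lambda>z. f z - g z) holomorphic2_on S"
proof (rule holomorphic2_onI_at)
  fix z assume z: "z \<in> S"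
  obtain A where A: "(f has_derivative (\<lambda>v. A *v v)) (at z)"
    using holomorphic2_on_derivative_at assms z by metis
  obtain B where B: "(g has_derivative (\<lambda>v. B *v v)) (at z)"
    using holomorphic2_on_derivative_at assms z by metis
  show "\<exists>A. ((\<lambda>z. f z - g z) has_derivative (\<lambda>v. A *v v)) (at z)"
    using has_derivative_diff[OF A B] by (auto simp: matrix_vector_mult_diff_rdistrib[symmetric])
qed

lemma holomorphic2_on_continuous_on:
  assumes "f holomorphic2_on S" shows "continuous_on S f"
  using assms unfolding holomorphic2_on_def
  by (meson continuous_on_eq_continuous_within has_derivative_continuous)

lemma bounded_linear_smult_left: "bounded_linear (\<lambda>c::complex. c *s (w :: complex^2))"
  unfolding linear_conv_bounded_linear[symmetric]
  by (rule linearI) (auto simp: vec_eq_iff algebra_simps)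

text \<open>Several-variable statements below are reduced to one variable by restriction to holomorphic discs;
  besides complex lines, the curves \<open>s \<mapsto> (s^k u, s^l v)\<close> occur.\<close>

lemma holomorphic_on_slice:
  fixes h :: "complex^2 \<Rightarrow> complex^2" and \<gamma> :: "complex \<Rightarrow> complex^2"
  assumes h: "h holomorphic2_on S" and S: "open S" and U: "open U"
    and \<gamma>: "(\<lambda>s. \<gamma> s $ 1) holomorphic_on U" "(\<lambda>s. \<gamma> s $ 2) holomorphic_on U"
    and sub: "\<gamma> ` U \<subseteq> S"
  shows "(\<lambda>s. h (\<gamma> s) $ i) holomorphic_on U"
  unfolding holomorphic_on_open[OF U]
proof
  fix s assume s: "s \<in> U"
  obtain d1 d2 where d: "((\<lambda>s. \<gamma> s $ 1) has_field_derivative d1) (at s)"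
    "((\<lambda>s. \<gamma> s $ 2) has_field_derivative d2) (at s)"
    using \<gamma> s U unfolding holomorphic_on_open[OF U] by blast
  define v :: "complex^2" where "v = vector [d1, d2]"
  have \<gamma>_eq: "\<gamma> = (\<lambda>s. (\<gamma> s $ 1) *s axis 1 1 + (\<gamma> s $ 2) *s axis 2 1)"
    by (auto simp: fun_eq_iff vec_eq_iff forall_2 axis_def)
  have v_eq: "(\<lambda>x. x *s v) = (\<lambda>x. (d1 * x) *s axis 1 1 + (d2 * x) *s axis 2 1)"
    by (auto simp: fun_eq_iff vec_eq_iff forall_2 axis_def v_def)
  have d\<gamma>: "(\<gamma> has_derivative (\<lambda>x. x *s v)) (at s)"
    unfolding v_eq
    by (subst \<gamma>_eq, intro has_derivative_add bounded_linear.has_derivative[OF bounded_linear_smult_left])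
       (use d in \<open>auto simp: has_field_derivative_def\<close>)
  obtain A where A: "(h has_derivative (\<lambda>v. A *v v)) (at (\<gamma> s))"
    using holomorphic2_on_derivative_at h S s sub by (metis imageI subsetD)
  have "((\<lambda>s. h (\<gamma> s) $ i) has_derivative (\<lambda>x. (A *v (x *s v)) $ i)) (at s)"
    by (rule bounded_linear.has_derivative[OF bounded_linear_vec_nth has_derivative_compose[OF d\<gamma> A]])
  moreover have "(\<lambda>x. (A *v (x *s v)) $ i) = (*) ((A *v v) $ i)"
    by (auto simp: fun_eq_iff vector_scalar_commute mult.commute)
  ultimately show "\<exists>f'. ((\<lambda>s. h (\<gamma> s) $ i) has_field_derivative f') (at s)"
    unfolding has_field_derivative_def by metis
qed

text \<open>On the complex line through \<open>w\<close> and \<open>p\<close> the one-variable identity theorem applies, because a line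
  meets a ball in a convex, hence connected, set.\<close>

lemma holomorphic2_identity_ball:
  assumes f: "f holomorphic2_on ball a r" and w: "w \<in> ball a r" and e: "e > 0"
    and z: "\<And>z. dist w z < e \<Longrightarrow> z \<in> ball a r \<Longrightarrow> f z = 0" and p: "p \<in> ball a r"
  shows "f p = 0"
proof -
  define \<gamma> where "\<gamma> = (\<lambda>s::complex. w + s *s (p - w))"
  have g[simp]: "\<gamma> 0 = w" "\<gamma> 1 = p" by (auto simp: \<gamma>_def vec_eq_iff)
  have \<gamma>i: "(\<lambda>s. \<gamma> s $ i) holomorphic_on X" for i X
    unfolding \<gamma>_def by (auto intro!: holomorphic_intros)
  have comp: "\<gamma> ((1-u) *\<^sub>R x + u *\<^sub>R y) = (1-u) *\<^sub>R \<gamma> x + u *\<^sub>R \<gamma> y" for u x y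
    unfolding \<gamma>_def vec_eq_iff vector_add_component vector_scaleR_component
    by (simp add: scaleR_conv_of_real[where 'a = complex] algebra_simps)
  have cont: "continuous_on X \<gamma>" for X
    using continuous_on_vec_lambda[where f = "\<lambda>i s. \<gamma> s $ i", OF holomorphic_on_imp_continuous_on[OF \<gamma>i]] by simp
  define U where "U = \<gamma> -` ball a r"
  have oU: "open U" unfolding U_def using cont by (simp add: open_vimage)
  have cU: "connected U"
  proof (rule convex_connected, unfold convex_alt, intro ballI allI impI)
    fix x y u assume "x \<in> U" "y \<in> U" "0 \<le> u \<and> u \<le> (1::real)"
    then show "(1-u) *\<^sub>R x + u *\<^sub>R y \<in> U"
      unfolding U_def vimage_eq comp using convex_ball[of a r] unfolding convex_alt by blast
  qed
  define V where "V = U \<inter> \<gamma> -` ball w e"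
  have oV: "open V" unfolding V_def using cont oU by (intro open_Int) (simp_all add: open_vimage)
  have V0: "0 \<in> V" using w e by (simp add: V_def U_def)
  have "f p $ i = 0" for i
  proof -
    have "(\<lambda>s. f (\<gamma> s) $ i) 1 = 0"
    proof (rule analytic_continuation[of _ U V 0 1])
      show "(\<lambda>s. f (\<gamma> s) $ i) holomorphic_on U"
        by (rule holomorphic_on_slice[OF f open_ball oU \<gamma>i \<gamma>i]) (auto simp: U_def)
      show "0 islimpt V" using oV V0 interior_limit_point interior_open by metis
    qed (use oU cU V0 p z in \<open>auto simp: V_def U_def\<close>)
    then show ?thesis by simp
  qed
  then show ?thesis by (simp add: vec_eq_iff)
qed

text \<open>The interior of the zero set of \<open>f - g\<close> is relatively closed: by the previous lemma, a ball in \<open>S\<close>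
  that contains one of its points lies in it entirely.\<close>

lemma holomorphic2_identity:
  assumes f: "f holomorphic2_on S" and g: "g holomorphic2_on S" and S: "open S" "connected S"
    and a: "a \<in> S" "e > 0" and eq: "\<And>z. z \<in> ball a e \<Longrightarrow> z \<in> S \<Longrightarrow> f z = g z" and p: "p \<in> S"
  shows "f p = g p"
proof -
  define h where "h = (\<lambda>z. f z - g z)"
  have h: "h holomorphic2_on S" unfolding h_def by (intro holomorphic2_on_diff f g S)
  define Z where "Z = {z \<in> S. \<exists>d>0. ball z d \<subseteq> S \<and> (\<forall>y\<in>ball z d. h y = 0)}"
  have oZ: "open Z" unfolding open_contains_ball
  proof
    fix z assume "z \<in> Z"
    then obtain d where d: "d > 0" "ball z d \<subseteq> S" "\<forall>y\<in>ball z d. h y = 0" by (auto simp: Z_def)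
    have "ball z d \<subseteq> Z"
    proof
      fix y assume y: "y \<in> ball z d"
      then obtain e where "e > 0" "ball y e \<subseteq> ball z d" using open_ball open_contains_ball by metis
      then show "y \<in> Z" using d y by (auto simp: Z_def)
    qed
    then show "\<exists>e>0. ball z e \<subseteq> Z" using d by blast
  qed
  have oN: "open (S - Z)" unfolding open_contains_ball
  proof
    fix z assume z: "z \<in> S - Z"
    then obtain d where d: "d > 0" "ball z d \<subseteq> S" using S open_contains_ball by blast
    have "y \<notin> Z" if y: "y \<in> ball z d" for y
    proof
      assume "y \<in> Z"
      then obtain e where e: "e > 0" "\<forall>x\<in>ball y e. h x = 0" by (auto simp: Z_def)
      have "h x = 0" if "x \<in> ball z d" for x
        using holomorphic2_identity_ball[OF holomorphic2_on_subset[OF h d(2)] y e(1) _ that] e by auto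
      then have "z \<in> Z" using z d by (auto simp: Z_def)
      with z show False by blast
    qed
    then show "\<exists>e>0. ball z e \<subseteq> S - Z" using d by blast
  qed
  obtain d where d: "d > 0" "ball a d \<subseteq> S" using S a open_contains_ball by blast
  have "ball a (min d e) \<subseteq> S" "\<forall>y\<in>ball a (min d e). h y = 0"
    using d a eq by (auto simp: h_def subset_iff)
  then have "a \<in> Z" using a d by (auto simp: Z_def intro!: exI[of _ "min d e"])
  moreover have "Z \<subseteq> S" by (auto simp: Z_def)
  ultimately have "Z = S"
    using connectedD[OF S(2) oZ oN] a by blast
  then have "p \<in> Z" using p by simp
  then have "h p = 0" by (auto simp: Z_def)
  then show ?thesis by (simp add: h_def)
qed


section \<open>Quantitative forms of the Schwarz lemma\<close>

text \<open>Division by any \<open>L > K\<close> produces the strict bound \<open>1\<close> on which the Schwarz lemma for the unit disc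
  relies; then \<open>L\<close> tends to \<open>K\<close>.\<close>

lemma Schwarz_scaled:
  assumes f: "f holomorphic_on ball 0 R" and R: "R > 0" and "f 0 = 0"
    and bd: "\<And>z. norm z < R \<Longrightarrow> norm (f z) \<le> K" and z: "norm z < R"
  shows "norm (f z) \<le> K * norm z / R"
proof -
  have K0: "K \<ge> 0" using bd[of 0] R assms(3) by simp
  have *: "norm (f z) \<le> L * norm z / R" if L: "L > K" for L
  proof -
    define g where "g = (\<lambda>w. f (of_real R * w) / of_real L)"
    have L0: "L > 0" using L K0 by simp
    have im: "of_real R * w \<in> ball 0 R" if "norm w < 1" for w :: complex
      using that R by (simp add: norm_mult)
    have "g holomorphic_on ball 0 1"
      unfolding g_def using L0 im
      by (intro holomorphic_intros holomorphic_on_compose_gen[OF _ f, unfolded o_def]) auto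
    moreover have "norm (g w) < 1" if "norm w < 1" for w
      using bd[of "of_real R * w"] im[OF that] L L0 by (simp add: g_def norm_divide)
    moreover have "norm (z / of_real R) < 1" using z R by (simp add: norm_divide)
    ultimately have "norm (g (z / of_real R)) \<le> norm (z / of_real R)"
      using assms(3) by (intro Schwarz_Lemma(1)) (auto simp: g_def)
    then show ?thesis using L0 R by (simp add: g_def norm_divide field_simps)
  qed
  have "\<forall>\<^sub>F L in at_right K. norm (f z) \<le> L * norm z / R"
    using * eventually_at_right_less by (rule eventually_mono[rotated])
  then show ?thesis
    by (intro tendsto_lowerbound[of "\<lambda>L. L * norm z / R" _ "at_right K"] tendsto_intros) (use R in auto)
qed

text \<open>The Schwarz lemma applied to \<open>f(z) / z\<close>, whose removable singularity has the value \<open>f'(0) = 0\<close>.\<close>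

lemma Schwarz_second_order:
  assumes f: "f holomorphic_on ball 0 R" and R: "R > 0" and "f 0 = 0" "deriv f 0 = 0"
    and bd: "\<And>z. norm z < R \<Longrightarrow> norm (f z) \<le> K * norm z" and z: "norm z < R"
  shows "norm (f z) \<le> K * (norm z)\<^sup>2 / R"
proof -
  define q where "q = (\<lambda>z. if z = 0 then deriv f 0 else (f z - f 0) / (z - 0))"
  have "q holomorphic_on ball 0 R"
    unfolding q_def by (rule pole_lemma[OF f]) (use R in simp)
  moreover have K: "K \<ge> 0"
    using bd[of "of_real (R/2)"] R
    by (smt (verit, best) norm_ge_zero norm_of_real mult_neg_pos half_gt_zero_iff field_sum_of_halves)
  have "norm (q w) \<le> K" if "norm w < R" for w
    using bd[OF that] assms(3,4) K by (auto simp: q_def norm_divide field_simps)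
  ultimately have "norm (q z) \<le> K * norm z / R"
    by (intro Schwarz_scaled) (use R z assms(4) in \<open>auto simp: q_def\<close>)
  then have "norm (q z) * norm z \<le> K * norm z / R * norm z"
    by (rule mult_right_mono) simp
  moreover have "norm (q z) * norm z = norm (f z)"
    using assms(3) by (auto simp: q_def norm_divide)
  ultimately show ?thesis by (simp add: power2_eq_square)
qed

lemma has_field_derivative_slice:
  fixes h :: "complex^2 \<Rightarrow> complex^2"
  assumes "(h has_derivative (\<lambda>v. A *v v)) (at 0)"
  shows "((\<lambda>s. h (s *s p) $ i) has_field_derivative (A *v p) $ i) (at 0)"
proof -
  have "((\<lambda>s. h (s *s p) $ i) has_derivative (\<lambda>x. (A *v (x *s p)) $ i)) (at 0)"
    by (rule bounded_linear.has_derivative[OF bounded_linear_vec_nth])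
       (rule has_derivative_compose[OF bounded_linear_imp_has_derivative[OF bounded_linear_smult_left]],
         simp add: assms)
  moreover have "(\<lambda>x. (A *v (x *s p)) $ i) = (*) ((A *v p) $ i)"
    by (auto simp: fun_eq_iff vector_scalar_commute mult.commute)
  ultimately show ?thesis unfolding has_field_derivative_def by metis
qed

text \<open>The Schwarz lemma on the disc of radius \<open>r / (2 \<bar>a - b\<bar>)\<close> in the line through \<open>b\<close> and \<open>a\<close>, with
  \<open>b\<close> at its centre; this disc stays inside the ball and contains the parameter \<open>1\<close> of \<open>a\<close>.\<close>

lemma bounded_holomorphic2_Lipschitz:
  assumes F: "F holomorphic2_on ball 0 r" and r: "r > 0" and M: "\<And>z. norm z < r \<Longrightarrow> norm (F z) \<le> M"
    and a: "norm a < r/4" and b: "norm b < r/4"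
  shows "norm (F a $ i - F b $ i) \<le> 4 * M / r * norm (a - b)"
proof (cases "a = b")
  case False
  define R where "R = (r/2) / norm (a - b)"
  have ab: "norm (a - b) > 0" "norm (a - b) < r/2"
    using False a b norm_triangle_ineq4[of a b] by auto
  then have R: "R > 1" by (simp add: R_def)
  have im: "norm (b + s *s (a - b)) < r" if "norm s < R" for s
  proof -
    have "norm s * norm (a - b) < r/2" using that ab by (simp add: R_def field_simps)
    then have "norm (s *s (a - b)) < r/2" by (simp only: norm_vec_smult)
    then show ?thesis
      using norm_triangle_ineq[of b "s *s (a - b)"] b r by linarith
  qed
  define \<phi> where "\<phi> = (\<lambda>s. F (b + s *s (a - b)) $ i - F b $ i)"
  have "\<phi> holomorphic_on ball 0 R"
    unfolding \<phi>_def
    by (intro holomorphic_intros holomorphic_on_slice[OF F]) (use im in \<open>auto intro!: holomorphic_intros\<close>)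
  moreover have "norm (\<phi> s) \<le> 2 * M" if "norm s < R" for s
  proof -
    have "norm (\<phi> s) \<le> norm (F (b + s *s (a - b)) $ i) + norm (F b $ i)"
      unfolding \<phi>_def by (rule norm_triangle_ineq4)
    also have "\<dots> \<le> norm (F (b + s *s (a - b))) + norm (F b)"
      by (intro add_mono Finite_Cartesian_Product.norm_nth_le)
    also have "\<dots> \<le> M + M" by (intro add_mono M im that) (use b r in auto)
    finally show ?thesis by simp
  qed
  ultimately have "norm (\<phi> 1) \<le> 2 * M * norm (1::complex) / R"
    by (intro Schwarz_scaled) (use R in \<open>auto simp: \<phi>_def\<close>)
  moreover have "\<phi> 1 = F a $ i - F b $ i" by (simp add: \<phi>_def)
  ultimately show ?thesis using ab r by (simp add: R_def field_simps)
qed simp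

text \<open>If the derivative vanishes at the origin, then \<open>F(s a) - F(s b)\<close> has a double zero at \<open>s = 0\<close>. The
  second-order Schwarz lemma on the disc of radius \<open>r / (4 \<delta>)\<close> gains a factor \<open>\<delta>\<close>, so that the
  Lipschitz constant is small near the origin, in terms of \<open>M\<close> and \<open>r\<close> only.\<close>

lemma flat_holomorphic2_Lipschitz:
  assumes F: "F holomorphic2_on ball 0 r" and r: "r > 0" and M: "\<And>z. norm z < r \<Longrightarrow> norm (F z) \<le> M"
    and d: "(F has_derivative (\<lambda>v. 0)) (at 0)" and \<delta>: "0 < \<delta>" "\<delta> < r/4"
    and a: "norm a < \<delta>" and b: "norm b < \<delta>"
  shows "norm (F a - F b) \<le> 32 * M * \<delta> / r\<^sup>2 * norm (a - b)"
proof -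
  define R where "R = r / (4 * \<delta>)"
  have R: "R > 1" using \<delta> r by (simp add: R_def)
  have im: "norm (s *s p) < r/4" if "norm s < R" "norm p < \<delta>" for s :: complex and p :: "complex^2"
  proof -
    have "norm s * norm p < R * \<delta>" using that by (intro mult_strict_mono) (use \<delta> R in auto)
    then show ?thesis using \<delta> by (simp add: R_def norm_vec_smult)
  qed
  have "norm (F a $ i - F b $ i) \<le> 16 * M * \<delta> / r\<^sup>2 * norm (a - b)" for i
  proof -
    define \<phi> where "\<phi> = (\<lambda>s. F (s *s a) $ i - F (s *s b) $ i)"
    have d': "(F has_derivative (\<lambda>v. 0 *v v)) (at 0)" using d by simp
    have "\<phi> holomorphic_on ball 0 R"
      unfolding \<phi>_def
      by (intro holomorphic_intros holomorphic_on_slice[OF F])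
         (use im a b r in \<open>fastforce intro!: holomorphic_intros\<close>)+
    moreover have "(\<phi> has_field_derivative ((0 *v a) $ i - (0 *v b) $ i)) (at 0)"
      unfolding \<phi>_def by (intro DERIV_diff has_field_derivative_slice d')
    then have "deriv \<phi> 0 = 0" using DERIV_imp_deriv by fastforce
    moreover have "norm (\<phi> s) \<le> (4 * M / r * norm (a - b)) * norm s" if "norm s < R" for s
    proof -
      have "s *s a - s *s b = s *s (a - b)" by (simp add: vec_eq_iff algebra_simps)
      then have "norm (s *s a - s *s b) = norm s * norm (a - b)" by (simp only: norm_vec_smult)
      then show ?thesis
        using bounded_holomorphic2_Lipschitz[OF F r M im[OF that a] im[OF that b], of i]
        by (simp add: \<phi>_def ac_simps)
    qed
    ultimately have "norm (\<phi> 1) \<le> (4 * M / r * norm (a - b)) * (norm (1::complex))\<^sup>2 / R"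
      by (intro Schwarz_second_order) (use R in \<open>auto simp: \<phi>_def\<close>)
    moreover have "\<phi> 1 = F a $ i - F b $ i" by (simp add: \<phi>_def)
    ultimately show ?thesis using \<delta> r by (simp add: R_def field_simps power2_eq_square)
  qed
  moreover have "32 * M * \<delta> / r\<^sup>2 * norm (a - b)
      = 16 * M * \<delta> / r\<^sup>2 * norm (a - b) + 16 * M * \<delta> / r\<^sup>2 * norm (a - b)" by simp
  ultimately show ?thesis
    using norm_le_sum_components[of "F a - F b"] unfolding vector_minus_component
    by (smt (verit, best))
qed

section \<open>Cartan uniqueness for self-maps of a bounded domain\<close>

lemma self_map_iterate:
  assumes g: "g holomorphic2_on D" and D: "open D" "0 \<in> D" "g ` D \<subseteq> D"
    and g0: "g 0 = 0" and dg: "(g has_derivative (\<lambda>v. A *v v)) (at 0)"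
  shows "(g ^^ n) holomorphic2_on D" "(g ^^ n) ` D \<subseteq> D" "(g ^^ n) 0 = 0"
    "((g ^^ n) has_derivative ((\<lambda>v. A *v v) ^^ n)) (at 0)"
proof (induction n)
  case 0
  { case 1 show ?case using holomorphic2_on_matrix[of "mat 1" D] by (simp add: id_def) }
  { case 2 show ?case by simp }
  { case 3 show ?case by simp }
  { case 4 show ?case by (simp add: id_def) }
next
  case (Suc n)
  { case 1 show ?case
      using holomorphic2_on_compose[OF Suc(1) g D(1) D(1) Suc(2)] by (simp add: o_def) }
  { case 2 show ?case using Suc(2) D(3) by auto }
  { case 3 show ?case using Suc(3) g0 by simp }
  { case 4 show ?case
      using has_derivative_compose[OF Suc(4), of g] dg Suc(3) by (simp add: o_def) }
qed

text \<open>Instead of comparing Taylor coefficients of iterates, sum them. Every \<open>g^n - id\<close> is bounded in terms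
  of \<open>D\<close> and flat at the origin, so it is \<open>1/2\<close>-Lipschitz on a ball that does not depend on \<open>n\<close>.
  Therefore \<open>\<Sum>n<N. (g^n (g a) - g^n a)\<close> differs from \<open>N (g a - a)\<close> by at most \<open>N \<bar>g a - a\<bar> / 2\<close>. But the
  sum telescopes to \<open>g^N a - a\<close>, which is bounded, and \<open>N \<rightarrow> \<infinity>\<close> gives \<open>g a = a\<close>.\<close>

theorem Cartan_uniqueness:
  assumes g: "g holomorphic2_on D" and D: "open D" "connected D" "bounded D" "0 \<in> D" "g ` D \<subseteq> D"
    and g0: "g 0 = 0" and dg: "(g has_derivative (\<lambda>v. v)) (at 0)" and "z \<in> D"
  shows "g z = z"
proof -
  obtain r where r: "r > 0" "ball 0 r \<subseteq> D" using D open_contains_ball by blast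
  obtain M where M: "M > 0" "\<And>z. z \<in> D \<Longrightarrow> norm z \<le> M" using D(3) bounded_pos by blast
  \<comment> \<open>The value makes the constant of \<open>flat_holomorphic2_Lipschitz\<close> at most \<open>1/2\<close>; the maps
    \<open>g^n - id\<close> are bounded by \<open>2 M\<close>.\<close>
  define \<delta> where "\<delta> = min (r/8) (r\<^sup>2 / (128 * M))"
  have \<delta>: "0 < \<delta>" "\<delta> < r/4" using r M by (auto simp: \<delta>_def)
  have "\<delta> \<le> r\<^sup>2 / (128 * M)" by (simp add: \<delta>_def)
  then have \<delta>2: "32 * (2*M) * \<delta> / r\<^sup>2 \<le> 1/2" using r M by (simp add: field_simps)
  have dg': "(g has_derivative (\<lambda>v. mat 1 *v v)) (at 0)" using dg by simp
  note it = self_map_iterate[OF g D(1,4,5) g0 dg']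
  have id_hol: "(\<lambda>z. z) holomorphic2_on X" for X
    using holomorphic2_on_matrix[of "mat 1" X] by simp
  have lip: "norm (((g ^^ n) a - a) - ((g ^^ n) b - b)) \<le> 1/2 * norm (a - b)"
    if "norm a < \<delta>" "norm b < \<delta>" for n a b
  proof -
    have "norm (((g ^^ n) a - a) - ((g ^^ n) b - b)) \<le> 32 * (2*M) * \<delta> / r\<^sup>2 * norm (a - b)"
    proof (rule flat_holomorphic2_Lipschitz[where F = "\<lambda>z. (g ^^ n) z - z", OF _ r(1) _ _ \<delta> that])
      show "(\<lambda>z. (g ^^ n) z - z) holomorphic2_on ball 0 r"
        by (intro holomorphic2_on_diff holomorphic2_on_subset[OF it(1) r(2)] id_hol open_ball)
      show "norm ((g ^^ n) z - z) \<le> 2 * M" if "norm z < r" for z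
      proof -
        have "z \<in> D" using that r by auto
        then show ?thesis using M(2)[of z] M(2)[of "(g ^^ n) z"] it(2)[of n]
          norm_triangle_ineq4[of "(g ^^ n) z" z] by fastforce
      qed
      have "((\<lambda>v. mat 1 *v v) ^^ n) = (\<lambda>v::complex^2. v)" by (induction n) auto
      then show "((\<lambda>z. (g ^^ n) z - z) has_derivative (\<lambda>v. 0)) (at 0)"
        using has_derivative_diff[OF it(4)[of n] has_derivative_ident] by simp
    qed
    also have "\<dots> \<le> 1/2 * norm (a - b)" using \<delta>2 by (rule mult_right_mono) simp
    finally show ?thesis .
  qed
  have fix_pt: "g a = a" if a: "norm a < \<delta>" "norm (g a) < \<delta>" for a
  proof (rule ccontr)
    assume "g a \<noteq> a"
    then have pos: "norm (g a - a) > 0" by simp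
    then obtain N :: nat where N: "4 * M < real N * norm (g a - a)"
      using reals_Archimedean3 by blast
    define e where "e = (\<lambda>n. ((g ^^ n) (g a) - g a) - ((g ^^ n) a - a))"
    have aD: "a \<in> D" using a \<delta> r by (auto simp: subset_iff)
    have "(\<Sum>n<N. e n) = (\<Sum>n<N. (g ^^ Suc n) a - (g ^^ n) a) - (\<Sum>n<N. g a - a)"
      unfolding sum_subtractf[symmetric]
      by (rule sum.cong) (simp_all add: e_def funpow_swap1)
    also have "\<dots> = ((g ^^ N) a - a) - real N *\<^sub>R (g a - a)"
      by (simp only: sum_lessThan_telescope[of "\<lambda>n. (g ^^ n) a"] sum_constant_scaleR card_lessThan funpow.simps(1) id_apply)
    finally have "(\<Sum>n<N. e n) = ((g ^^ N) a - a) - real N *\<^sub>R (g a - a)" .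
    then have eq: "real N *\<^sub>R (g a - a) = ((g ^^ N) a - a) - (\<Sum>n<N. e n)"
      by (metis diff_diff_eq2 add_diff_cancel_left')
    have "norm (\<Sum>n<N. e n) \<le> (\<Sum>n<N. 1/2 * norm (g a - a))"
      by (rule sum_norm_le) (use lip[OF a(2,1)] in \<open>simp add: e_def\<close>)
    moreover have "norm ((g ^^ N) a - a) \<le> 2 * M"
      using M(2)[OF aD] M(2)[of "(g ^^ N) a"] it(2)[of N] aD
        norm_triangle_ineq4[of "(g ^^ N) a" a] by fastforce
    ultimately have "norm (real N *\<^sub>R (g a - a)) \<le> 2 * M + real N * (norm (g a - a) / 2)"
      unfolding eq using norm_triangle_ineq4[of "(g ^^ N) a - a" "\<Sum>n<N. e n"] by simp
    with N show False by simp
  qed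
  have "isCont g 0" using dg has_derivative_continuous by blast
  then obtain \<eta> where \<eta>: "\<eta> > 0" "\<And>x. dist x 0 < \<eta> \<Longrightarrow> dist (g x) (g 0) < \<delta>"
    unfolding continuous_at_eps_delta using \<delta> by blast
  show ?thesis
  proof (rule holomorphic2_identity[OF g id_hol D(1,2,4) _ _ \<open>z \<in> D\<close>])
    show "min \<delta> \<eta> > 0" using \<delta> \<eta> by simp
    show "g z = z" if "z \<in> ball 0 (min \<delta> \<eta>)" for z
      using fix_pt[of z] \<eta>(2)[of z] that g0 by simp
  qed
qed

text \<open>Cartan uniqueness for \<open>u' \<circ> v\<close>, whose derivative at the origin is the identity.\<close>

theorem automorphism_determined_by_derivative:
  assumes D: "open D" "connected D" "bounded D" "0 \<in> D"
    and u: "u holomorphic2_on D" "u ` D \<subseteq> D" "u 0 = 0" "(u has_derivative (\<lambda>v. A *v v)) (at 0)"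
    and u': "u' holomorphic2_on D" "u' ` D \<subseteq> D"
      "\<And>z. z \<in> D \<Longrightarrow> u' (u z) = z" "\<And>z. z \<in> D \<Longrightarrow> u (u' z) = z"
    and v: "v holomorphic2_on D" "v ` D \<subseteq> D" "v 0 = 0" "(v has_derivative (\<lambda>v. A *v v)) (at 0)"
    and z: "z \<in> D"
  shows "u z = v z"
proof -
  obtain B where B: "(u' has_derivative (\<lambda>v. B *v v)) (at 0)"
    using holomorphic2_on_derivative_at[OF u'(1) D(1,4)] by metis
  have "((\<lambda>z. u' (u z)) has_derivative (\<lambda>x. B *v (A *v x))) (at 0)"
    using has_derivative_compose[OF u(4), of u'] B u(3) by simp
  then have "((\<lambda>z. z) has_derivative (\<lambda>x. B *v (A *v x))) (at 0)"
    by (rule has_derivative_transform_within_open[OF _ D(1,4)]) (use u' in auto)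
  then have BA: "(\<lambda>x. B *v (A *v x)) = (\<lambda>x. x)"
    using has_derivative_unique has_derivative_ident by blast
  have "u' (v z) = z"
  proof (rule Cartan_uniqueness[where g = "\<lambda>z. u' (v z)", OF _ D])
    show "(\<lambda>z. u' (v z)) holomorphic2_on D" by (rule holomorphic2_on_compose) (use u' v D in auto)
    show "((\<lambda>z. u' (v z)) has_derivative (\<lambda>v. v)) (at 0)"
      using has_derivative_compose[OF v(4), of u' "\<lambda>v. B *v v"] B unfolding v(3) BA by blast
    show "u' (v 0) = 0" using u'(3)[OF D(4)] u(3) v(3) by simp
  qed (use u' v z in \<open>auto simp: image_subset_iff\<close>)
  then show ?thesis using u'(4)[of "v z"] v(2) z by force
qed

section \<open>Power-bounded matrices of size two\<close>

definition power_bounded :: "complex^2^2 \<Rightarrow> bool" where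
  "power_bounded A \<longleftrightarrow> (\<forall>v. \<exists>C. \<forall>n. norm (((\<lambda>v. A *v v) ^^ n) v) \<le> C)"

text \<open>The iterates of \<open>g\<close> have the powers of \<open>A\<close> as derivatives, and they are bounded by the same constant.\<close>

lemma power_bounded_self_map_derivative:
  assumes g: "g holomorphic2_on D" and D: "open D" "bounded D" "0 \<in> D" "g ` D \<subseteq> D"
    and g0: "g 0 = 0" and dg: "(g has_derivative (\<lambda>v. A *v v)) (at 0)"
  shows "power_bounded A"
  unfolding power_bounded_def
proof (intro allI)
  fix v :: "complex^2"
  obtain r where r: "r > 0" "ball 0 r \<subseteq> D" using D open_contains_ball by blast
  obtain M where M: "M > 0" "\<And>z. z \<in> D \<Longrightarrow> norm z \<le> M" using D(2) bounded_pos by blast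
  note it = self_map_iterate[OF g D(1,3,4) g0 dg]
  define R where "R = r / (2 * (norm v + 1))"
  have nv: "norm v + 1 > 0" by (rule add_nonneg_pos) auto
  have R: "R > 0" using r nv by (simp add: R_def)
  have im: "s *s v \<in> D" if "norm s < 2 * R" for s
  proof -
    have "norm s * norm v \<le> (2 * R) * norm v" using that by (intro mult_right_mono) auto
    also have "\<dots> < (2 * R) * (norm v + 1)" using R by simp
    also have "\<dots> = r" using nv by (simp add: R_def field_simps)
    finally show ?thesis using r by (auto simp: norm_vec_smult)
  qed
  have "norm ((((\<lambda>v. A *v v) ^^ n) v) $ i) \<le> M / R" for n i
  proof -
    define \<phi> where "\<phi> = (\<lambda>s. (g ^^ n) (s *s v) $ i)"
    obtain B where B: "((g ^^ n) has_derivative (\<lambda>v. B *v v)) (at 0)"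
      using holomorphic2_on_derivative_at[OF it(1) D(1,3)] by metis
    have Beq: "(\<lambda>v. B *v v) = ((\<lambda>v. A *v v) ^^ n)"
      using has_derivative_unique[OF B it(4)] .
    have hol: "\<phi> holomorphic_on ball 0 (2 * R)"
      unfolding \<phi>_def
      by (rule holomorphic_on_slice[OF it(1) D(1)]) (use im in \<open>auto intro!: holomorphic_intros\<close>)
    have "norm ((deriv ^^ 1) \<phi> 0) \<le> fact 1 * M / R ^ 1"
    proof (rule Cauchy_inequality)
      show "\<phi> holomorphic_on ball 0 R" using hol by (rule holomorphic_on_subset) (use R in auto)
      show "continuous_on (cball 0 R) \<phi>"
        by (rule continuous_on_subset[OF holomorphic_on_imp_continuous_on[OF hol]]) (use R in auto)
      fix s :: complex assume "norm (0 - s) = R"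
      then have "s *s v \<in> D" using R by (intro im) auto
      then have "norm ((g ^^ n) (s *s v)) \<le> M" using it(2)[of n] M by blast
      then show "norm (\<phi> s) \<le> M"
        unfolding \<phi>_def using Finite_Cartesian_Product.norm_nth_le order_trans by blast
    qed (fact R)
    moreover have "(deriv ^^ 1) \<phi> 0 = (B *v v) $ i"
      using DERIV_imp_deriv[OF has_field_derivative_slice[OF B]] by (simp add: \<phi>_def)
    ultimately show ?thesis using fun_cong[OF Beq, of v] by simp
  qed
  then have "norm (((\<lambda>v. A *v v) ^^ n) v) \<le> M / R + M / R" for n
    using norm_le_sum_components[of "((\<lambda>v. A *v v) ^^ n) v"] by (smt (verit, best))
  then show "\<exists>C. \<forall>n. norm (((\<lambda>v. A *v v) ^^ n) v) \<le> C" by blast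
qed

lemma eigenvector_2:
  fixes A :: "complex^2^2"
  assumes "\<mu>\<^sup>2 - (A$1$1 + A$2$2) * \<mu> + det A = 0"
  obtains v where "v \<noteq> 0" "A *v v = \<mu> *s v"
proof -
  have eq: "(\<mu> - A$1$1) * (\<mu> - A$2$2) = A$1$2 * A$2$1"
    using assms by (simp add: det_2 algebra_simps power2_eq_square)
  have ex: "\<exists>v. v \<noteq> 0 \<and> A *v v = \<mu> *s v"
  proof (cases "A$1$2 = 0 \<and> A$2$1 = 0")
    case True
    then have "\<mu> = A$1$1 \<or> \<mu> = A$2$2" using eq by simp
    then show ?thesis
    proof
      assume "\<mu> = A$1$1"
      then show ?thesis using True
        by (intro exI[of _ "vector [1, 0]"]) (simp add: vec_eq_iff forall_2 matrix_vector_mult_def sum_2)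
    next
      assume "\<mu> = A$2$2"
      then show ?thesis using True
        by (intro exI[of _ "vector [0, 1]"]) (simp add: vec_eq_iff forall_2 matrix_vector_mult_def sum_2)
    qed
  next
    case False
    then show ?thesis
    proof (cases "A$1$2 = 0")
      case True
      then show ?thesis using False eq
        by (intro exI[of _ "vector [\<mu> - A$2$2, A$2$1]"])
          (auto simp: vec_eq_iff forall_2 matrix_vector_mult_def sum_2 algebra_simps)
    next
      case nz: False
      then show ?thesis using eq
        by (intro exI[of _ "vector [A$1$2, \<mu> - A$1$1]"])
          (auto simp: vec_eq_iff forall_2 matrix_vector_mult_def sum_2 algebra_simps)
    qed
  qed
  then show ?thesis using that by blast
qed

lemma power_bounded_eigenvalue:
  assumes A: "power_bounded A" and v: "v \<noteq> 0" "A *v v = \<mu> *s v"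
  shows "norm \<mu> \<le> 1"
proof (rule ccontr)
  assume "\<not> norm \<mu> \<le> 1"
  then have gt: "norm \<mu> > 1" by simp
  obtain C where C: "\<And>n. norm (((\<lambda>v. A *v v) ^^ n) v) \<le> C"
    using A unfolding power_bounded_def by blast
  have "((\<lambda>v. A *v v) ^^ n) v = \<mu> ^ n *s v" for n
    by (induction n) (auto simp: v vector_scalar_commute vector_smult_assoc)
  then have le: "norm \<mu> ^ n * norm v \<le> C" for n
    using C[of n] by (simp add: norm_vec_smult norm_power)
  obtain n where "C / norm v < norm \<mu> ^ n" using real_arch_pow[OF gt] by blast
  then show False using le[of n] v(1) by (simp add: field_simps)
qed

text \<open>Both eigenvalues lie in the closed unit disc and their product is unimodular, so both are unimodular
  and, after division by \<open>\<delta>\<close>, conjugate to each other; \<open>c\<close> is their common real part. If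
  \<open>\<bar>c\<bar> = 1\<close> they coincide, and since a nontrivial Jordan block is not power-bounded, the matrix is
  scalar.\<close>

lemma power_bounded_trace:
  assumes A: "power_bounded A" and det: "det A = \<delta>\<^sup>2" and \<delta>: "norm \<delta> = 1"
  shows "\<exists>c::real. A$1$1 + A$2$2 = 2 * of_real c * \<delta> \<and> \<bar>c\<bar> \<le> 1 \<and>
    (\<bar>c\<bar> = 1 \<longrightarrow> A$1$2 = 0 \<and> A$2$1 = 0)"
proof -
  define t where "t = A$1$1 + A$2$2"
  define s where "s = csqrt (t\<^sup>2 - 4 * det A)"
  define \<mu> where "\<mu> = (t + s) / 2"
  define \<mu>' where "\<mu>' = (t - s) / 2"
  have s2: "s\<^sup>2 = t\<^sup>2 - 4 * det A" by (simp add: s_def)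
  have sum: "\<mu> + \<mu>' = t" by (simp add: \<mu>_def \<mu>'_def field_simps)
  have prod: "\<mu> * \<mu>' = det A"
    using s2 by (simp add: \<mu>_def \<mu>'_def field_simps power2_eq_square)
  have le: "norm x \<le> 1" if "x = \<mu> \<or> x = \<mu>'" for x
  proof -
    have "x\<^sup>2 - t * x + det A = 0"
      using that by (auto simp: prod[symmetric] sum[symmetric] algebra_simps power2_eq_square)
    then show ?thesis using eigenvector_2[of x A] power_bounded_eigenvalue[OF A] unfolding t_def by metis
  qed
  have "norm \<mu> * norm \<mu>' = 1"
    unfolding norm_mult[symmetric] prod det using \<delta> by (simp add: norm_power)
  moreover have "norm \<mu> * norm \<mu>' \<le> norm \<mu> * 1" using le by (intro mult_left_mono) auto
  ultimately have \<mu>: "norm \<mu> = 1" using le[of \<mu>] by simp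
  define \<nu> where "\<nu> = \<mu> / \<delta>"
  have \<nu>: "norm \<nu> = 1" using \<mu> \<delta> by (simp add: \<nu>_def norm_divide)
  have nz: "\<mu> \<noteq> 0" "\<delta> \<noteq> 0" using \<mu> \<delta> by auto
  have "\<nu> * cnj \<nu> = 1" using \<nu> by (simp add: complex_norm_square[symmetric])
  moreover have "\<nu> * (\<mu>' / \<delta>) = 1"
    using prod det nz by (simp add: \<nu>_def field_simps power2_eq_square)
  moreover have "\<nu> \<noteq> 0" using nz by (simp add: \<nu>_def)
  ultimately have "cnj \<nu> = \<mu>' / \<delta>" by (metis mult_left_cancel)
  then have "t / \<delta> = \<nu> + cnj \<nu>" by (simp add: sum[symmetric] \<nu>_def add_divide_distrib)
  then have tr: "t = 2 * of_real (Re \<nu>) * \<delta>"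
    using nz by (simp add: complex_add_cnj field_simps)
  have "A$1$2 = 0 \<and> A$2$1 = 0" if "\<bar>Re \<nu>\<bar> = 1"
  proof -
    have "(Re \<nu>)\<^sup>2 = 1" using that by (metis power2_abs one_power2)
    moreover have "(Re \<nu>)\<^sup>2 + (Im \<nu>)\<^sup>2 = 1" using \<nu> by (simp add: cmod_def)
    ultimately have "\<nu> = of_real (Re \<nu>)" by (simp add: complex_eq_iff)
    then have "\<nu>\<^sup>2 = 1" using \<open>(Re \<nu>)\<^sup>2 = 1\<close> by (metis of_real_1 of_real_power)
    then have "\<mu>\<^sup>2 = \<delta>\<^sup>2" using nz by (simp add: \<nu>_def field_simps)
    then have "\<mu> * \<mu>' = \<mu> * \<mu>" using prod det by (simp add: power2_eq_square)
    then have double: "t = 2 * \<mu>" "det A = \<mu>\<^sup>2" using nz sum det \<open>\<mu>\<^sup>2 = \<delta>\<^sup>2\<close> by auto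
    \<comment> \<open>The vector \<open>w\<close> measures the failure of \<open>v\<close> to be an eigenvector. It is itself an eigenvector or
      zero, so the powers of \<open>A\<close> at \<open>v\<close> grow linearly in \<open>n \<bar>w\<bar>\<close>.\<close>
    have eig: "A *v v = \<mu> *s v" for v
    proof -
      define w where "w = (1/\<mu>) *s (A *v v) - v"
      have Av: "A *v v = \<mu> *s (v + w)" using nz by (simp add: w_def vector_smult_assoc vec_eq_iff)
      have CH: "A *v (A *v v) = (2 * \<mu>) *s (A *v v) - \<mu>\<^sup>2 *s v"
        unfolding double(2)[symmetric] double(1)[symmetric] t_def
        by (simp add: vec_eq_iff forall_2 matrix_vector_mult_def sum_2 det_2 algebra_simps)
      have Aw: "A *v w = \<mu> *s w"
        using nz by (simp add: w_def matrix_vector_mult_diff_distrib vector_scalar_commute CH)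
          (simp add: vec_eq_iff field_simps power2_eq_square)
      obtain C where C: "\<And>n. norm (((\<lambda>v. A *v v) ^^ n) v) \<le> C"
        using A unfolding power_bounded_def by blast
      have it: "((\<lambda>v. A *v v) ^^ n) v = \<mu> ^ n *s (v + of_nat n *s w)" for n
      proof (induction n)
        case (Suc n)
        have "((\<lambda>v. A *v v) ^^ Suc n) v = A *v (\<mu> ^ n *s (v + of_nat n *s w))" using Suc by simp
        also have "\<dots> = \<mu> ^ n *s (\<mu> *s (v + w) + of_nat n *s (\<mu> *s w))"
          by (simp only: vector_scalar_commute matrix_vector_right_distrib Av Aw)
        also have "\<dots> = \<mu> ^ Suc n *s (v + of_nat (Suc n) *s w)"
          by (simp add: vec_eq_iff algebra_simps)
        finally show ?case .
      qed simp
      have bd: "real n * norm w \<le> C + norm v" for n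
      proof -
        have "real n * norm w = norm ((v + of_nat n *s w) - v)" by (simp add: norm_vec_smult)
        also have "\<dots> \<le> norm (v + of_nat n *s w) + norm v" by (rule norm_triangle_ineq4)
        also have "\<dots> \<le> C + norm v"
          using C[of n] \<mu> unfolding it norm_vec_smult by (simp add: norm_power)
        finally show ?thesis .
      qed
      have "norm w = 0"
      proof (rule ccontr)
        assume "norm w \<noteq> 0"
        then obtain n where "C + norm v < real n * norm w" using reals_Archimedean3[of "norm w"] by auto
        with bd[of n] show False by simp
      qed
      then show ?thesis using Av by simp
    qed
    show ?thesis
      using eig[of "vector [1, 0]"] eig[of "vector [0, 1]"]
      by (simp add: vec_eq_iff forall_2 matrix_vector_mult_def sum_2)
  qed
  moreover have "\<bar>Re \<nu>\<bar> \<le> 1" using abs_Re_le_cmod[of \<nu>] \<nu> by simp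
  ultimately show ?thesis using tr unfolding t_def by blast
qed

section \<open>Linearity from equivariance\<close>

definition rotation :: "nat \<Rightarrow> nat \<Rightarrow> real \<Rightarrow> complex^2^2" where
  "rotation k l \<theta> = vector [vector [cis (real k * \<theta>), 0], vector [0, cis (real l * \<theta>)]]"

lemma rotation_mult: "rotation k l \<theta> *v z = vector [cis (real k * \<theta>) * z $ 1, cis (real l * \<theta>) * z $ 2]"
  by (simp add: rotation_def vec_eq_iff forall_2 matrix_vector_mult_def sum_2)

lemma rotation_nth: "rotation k l \<theta> $ 1 $ 1 = cis (real k * \<theta>)" "rotation k l \<theta> $ 1 $ 2 = 0"
    "rotation k l \<theta> $ 2 $ 1 = 0" "rotation k l \<theta> $ 2 $ 2 = cis (real l * \<theta>)"
  by (simp_all add: rotation_def)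

lemma rotation_inverse: "rotation k l (-\<theta>) *v (rotation k l \<theta> *v z) = z"
  "rotation k l \<theta> *v (rotation k l (-\<theta>) *v z) = z"
  by (simp_all add: rotation_mult vec_eq_iff forall_2 mult.assoc[symmetric] cis_mult)

text \<open>A function of weight \<open>k\<close> is a multiple of the coordinate \<open>u\<close> of weight \<open>k\<close>. Roots of unity of order
  \<open>l\<close> fix \<open>v\<close> and multiply the value by a nontrivial factor, so the function vanishes on \<open>u = 0\<close>.
  Thus the difference to its linear part \<open>a u\<close> vanishes there and is bounded by \<open>\<epsilon> max \<bar>u\<bar> \<bar>v\<bar>\<close> near the
  origin, hence by \<open>\<epsilon> \<bar>u\<bar>\<close> according to the Schwarz lemma in \<open>u\<close>. This bound is invariant under
  \<open>(u, v) \<mapsto> (t^k u, t^l v)\<close> with \<open>0 < t < 1\<close> and so extends to the whole bidisc. The argument does not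
  depend on which weight is larger, so it covers both components of a map.\<close>

lemma weight_component_linear:
  fixes p :: "complex \<Rightarrow> complex \<Rightarrow> complex"
  assumes kl: "coprime k l" "1 \<le> k" "2 \<le> l" and r: "r > 0"
    and slice1: "\<And>v. norm v < r \<Longrightarrow> (\<lambda>u. p u v) holomorphic_on ball 0 r"
    and slice2: "\<And>u v. norm u < r \<Longrightarrow> norm v < r \<Longrightarrow>
      (\<lambda>s. p (s^k * u) (s^l * v)) holomorphic_on {s. norm (s^k * u) < r \<and> norm (s^l * v) < r}"
    and eqv: "\<And>\<theta> u v. norm u < r \<Longrightarrow> norm v < r \<Longrightarrow>
      p (cis (real k * \<theta>) * u) (cis (real l * \<theta>) * v) = cis (real k * \<theta>) * p u v"
    and lin: "\<And>\<epsilon>. \<epsilon> > 0 \<Longrightarrow> \<exists>s>0. \<forall>u v. norm u < s \<and> norm v < s \<longrightarrow>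
      norm (p u v - (a * u + b * v)) \<le> \<epsilon> * max (norm u) (norm v)"
    and u: "norm u < r" and v: "norm v < r"
  shows "p u v = a * u"
proof -
  have zero: "p 0 w = 0" if w: "norm w < r" for w
  proof -
    define \<theta> where "\<theta> = 2 * pi / real l"
    have "cis (real k * \<theta>) \<noteq> 1"
    proof
      assume "cis (real k * \<theta>) = 1"
      then have "exp (2 * of_real pi * \<i> * of_nat k / of_nat l) = 1"
        by (simp add: cis_conv_exp \<theta>_def mult_ac)
      then have "l dvd k" using kl complex_root_unity_eq_1[of l k] by simp
      then have "l dvd 1" using kl(1) by (metis coprime_def dvd_refl)
      with kl(3) show False by simp
    qed
    moreover have "cis (real l * \<theta>) = 1" using kl(3) by (simp add: \<theta>_def)
    ultimately show ?thesis using eqv[of 0 w \<theta>] w r by simp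
  qed
  have b0: "b = 0"
  proof (rule ccontr)
    assume b: "b \<noteq> 0"
    obtain s where s: "s > 0" "\<And>u v. norm u < s \<and> norm v < s \<Longrightarrow>
        norm (p u v - (a * u + b * v)) \<le> norm b / 2 * max (norm u) (norm v)"
      using lin[of "norm b / 2"] b by auto
    define w :: complex where "w = of_real (min s r / 2)"
    have w: "norm w < s" "norm w < r" "norm w > 0" using s r by (auto simp: w_def)
    have "norm b * norm w \<le> norm b / 2 * norm w"
      using s(2)[of 0 w] w s(1) zero[OF w(2)] by (simp add: norm_mult)
    then show False using b w by simp
  qed
  \<comment> \<open>Equivariance under the unit circle extends to the unit disc by the maximum principle.\<close>
  have scale: "p (s^k * u) (s^l * v) = s^k * p u v" if s: "norm s < 1" for s
  proof -
    define U where "U = {s. norm (s^k * u) < r \<and> norm (s^l * v) < r}"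
    define \<phi> where "\<phi> = (\<lambda>s. p (s^k * u) (s^l * v) - s^k * p u v)"
    have le: "norm (s ^ n * x) < r" if "norm s \<le> 1" "norm x < r" for s x :: complex and n
    proof -
      have "norm s ^ n * norm x \<le> 1 * norm x"
        using that power_le_one[of "norm s" n] by (intro mult_right_mono) auto
      then show ?thesis using that by (simp add: norm_mult norm_power)
    qed
    have sub: "cball 0 1 \<subseteq> U" using le u v by (auto simp: U_def)
    have hol: "\<phi> holomorphic_on U"
      unfolding \<phi>_def U_def by (intro holomorphic_intros slice2 u v)
    have "norm (\<phi> s) \<le> 0"
    proof (rule maximum_modulus_frontier[of \<phi> "cball 0 1"])
      show "\<phi> holomorphic_on interior (cball 0 1)"
        using hol by (rule holomorphic_on_subset) (use sub interior_subset in blast)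
      show "continuous_on (closure (cball 0 1)) \<phi>"
        using holomorphic_on_imp_continuous_on[OF hol] sub continuous_on_subset by auto
      show "s \<in> cball 0 1" using s by simp
      fix z :: complex assume "z \<in> frontier (cball 0 1)"
      then have "norm z = 1" by simp
      then obtain \<theta> where \<theta>: "z = cis \<theta>" by (metis complex_norm_eq_1_exp cis_conv_exp mult.commute)
      show "norm (\<phi> z) \<le> 0" using eqv[OF u v, of \<theta>] by (simp add: \<phi>_def \<theta> Complex.DeMoivre)
    qed simp
    then show ?thesis by (simp add: \<phi>_def)
  qed
  have small: "norm (p u v - a * u) \<le> \<epsilon> * norm u" if \<epsilon>: "\<epsilon> > 0" for \<epsilon>
  proof -
    obtain s where s: "s > 0" "\<And>u v. norm u < s \<and> norm v < s \<Longrightarrow>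
        norm (p u v - (a * u + b * v)) \<le> \<epsilon> * max (norm u) (norm v)"
      using lin[OF \<epsilon>] by auto
    define \<rho> where "\<rho> = min s r"
    have \<rho>: "\<rho> > 0" "\<rho> \<le> s" "\<rho> \<le> r" using s r by (auto simp: \<rho>_def)
    \<comment> \<open>The bound by the maximum is turned into a bound by the first coordinate alone.\<close>
    have schwarz: "norm (p x y - a * x) \<le> \<epsilon> * norm x" if x: "norm x < \<rho>" and y: "norm y < \<rho>" for x y
    proof -
      have "norm (p x y - a * x) \<le> (\<epsilon> * \<rho>) * norm x / \<rho>"
      proof (rule Schwarz_scaled[where f = "\<lambda>x. p x y - a * x", OF _ \<rho>(1) _ _ x])
        show "(\<lambda>x. p x y - a * x) holomorphic_on ball 0 \<rho>"
          by (intro holomorphic_intros holomorphic_on_subset[OF slice1]) (use y \<rho> in auto)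
        show "p 0 y - a * 0 = 0" using zero y \<rho> by simp
        fix z :: complex assume z: "norm z < \<rho>"
        then have "norm (p z y - a * z) \<le> \<epsilon> * max (norm z) (norm y)"
          using s(2)[of z y] y \<rho> b0 by simp
        also have "\<dots> \<le> \<epsilon> * \<rho>" using z y \<epsilon> by (intro mult_left_mono) auto
        finally show "norm (p z y - a * z) \<le> \<epsilon> * \<rho>" .
      qed
      then show ?thesis using \<rho> by simp
    qed
    define t where "t = min 1 (\<rho> / r) / 2"
    have t: "0 < t" "t < 1" "t * r < \<rho>" using \<rho> r by (auto simp: t_def min_def field_simps)
    have im: "norm (of_real t ^ n * x) < \<rho>" if "norm x < r" "n \<ge> 1" for x :: complex and n
    proof -
      have "t ^ n \<le> t ^ 1" using t that by (intro power_decreasing) auto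
      then have "t ^ n * norm x \<le> t * r" using t that by (intro mult_mono) auto
      then show ?thesis using t by (simp add: norm_mult norm_power)
    qed
    have "of_real t ^ k * (p u v - a * u) = p (of_real t ^ k * u) (of_real t ^ l * v) - a * (of_real t ^ k * u)"
      using scale[of "of_real t"] t by (simp add: algebra_simps)
    then have "norm (of_real t ^ k * (p u v - a * u)) \<le> \<epsilon> * norm (of_real t ^ k * u)"
      using schwarz[of "of_real t ^ k * u" "of_real t ^ l * v"] im u v kl by simp
    then show ?thesis using t by (simp add: norm_mult norm_power mult.left_commute[of \<epsilon>])
  qed
  have "norm (p u v - a * u) \<le> 0"
  proof (rule field_le_epsilon)
    fix e :: real assume e: "e > 0"
    have "norm (p u v - a * u) \<le> e / (norm u + 1) * norm u"
      using e by (intro small divide_pos_pos add_nonneg_pos) auto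
    also have "\<dots> \<le> e" using e by (simp add: divide_le_eq add_nonneg_pos mult_left_mono)
    finally show "norm (p u v - a * u) \<le> 0 + e" by simp
  qed
  then show ?thesis by simp
qed

lemma has_derivative_at_0_littleo:
  fixes h :: "complex^2 \<Rightarrow> complex^2"
  assumes "(h has_derivative (\<lambda>v. A *v v)) (at 0)" "h 0 = 0" "\<epsilon> > 0"
  shows "\<exists>s>0. \<forall>z. norm z < s \<longrightarrow> norm (h z - A *v z) \<le> \<epsilon> * norm z"
  using assms unfolding has_derivative_within_alt by auto

text \<open>Each component is a weight vector: the previous lemma applies to the first one directly and to the
  second one with the coordinates interchanged.\<close>

theorem rotation_equivariant_linear:
  assumes kl: "coprime k l" "2 \<le> k" "2 \<le> l" and h: "h holomorphic2_on S" and S: "open S" "0 \<in> S"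
    and h0: "h 0 = 0" and dh: "(h has_derivative (\<lambda>v. A *v v)) (at 0)"
    and eqv: "\<And>\<theta> z. z \<in> S \<Longrightarrow> rotation k l \<theta> *v z \<in> S \<Longrightarrow>
      h (rotation k l \<theta> *v z) = rotation k l \<theta> *v h z"
  shows "\<exists>e>0. \<forall>z. norm z < e \<longrightarrow> h z = A *v z"
proof -
  obtain R where R: "R > 0" "ball 0 R \<subseteq> S" using S open_contains_ball by blast
  define r where "r = R / 2"
  have r: "r > 0" using R by (simp add: r_def)
  have inS: "vector [u, v] \<in> S" if "norm u < r" "norm v < r" for u v :: complex
    using norm_le_sum_components[of "vector [u, v]"] that R(2) by (auto simp: r_def subset_iff)
  have nv: "norm (vector [u, v] :: complex^2) \<le> 2 * max (norm u) (norm v)" for u v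
    using norm_le_sum_components[of "vector [u, v]"] by simp
  have little: "\<exists>s>0. \<forall>u v. norm u < s \<and> norm v < s \<longrightarrow>
      norm (h (vector [u, v]) $ i - (A $ i $ 1 * u + A $ i $ 2 * v)) \<le> \<epsilon> * max (norm u) (norm v)"
    if \<epsilon>: "\<epsilon> > 0" for \<epsilon> i
  proof -
    obtain s where s: "s > 0" "\<And>z. norm z < s \<Longrightarrow> norm (h z - A *v z) \<le> \<epsilon> / 2 * norm z"
      using has_derivative_at_0_littleo[OF dh h0, of "\<epsilon>/2"] \<epsilon> by auto
    have "norm (h (vector [u, v]) $ i - (A $ i $ 1 * u + A $ i $ 2 * v)) \<le> \<epsilon> * max (norm u) (norm v)"
      if "norm u < s/2" "norm v < s/2" for u v
    proof -
      define z :: "complex^2" where "z = vector [u, v]"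
      have "norm z < s" unfolding z_def using nv[of u v] that by simp
      have "norm (h z $ i - (A *v z) $ i) \<le> norm (h z - A *v z)"
        using Finite_Cartesian_Product.norm_nth_le[of "h z - A *v z" i] by simp
      also have "\<dots> \<le> \<epsilon> / 2 * norm z" by (rule s) fact
      also have "\<dots> \<le> \<epsilon> / 2 * (2 * max (norm u) (norm v))"
        unfolding z_def using \<epsilon> nv by (intro mult_left_mono) auto
      finally show ?thesis by (simp add: z_def matrix_vector_mult_def sum_2)
    qed
    then show ?thesis using s(1) by (intro exI[of _ "s/2"]) auto
  qed
  have eqv': "h (vector [cis (real k * \<theta>) * u, cis (real l * \<theta>) * v])
      = vector [cis (real k * \<theta>) * h (vector [u, v]) $ 1, cis (real l * \<theta>) * h (vector [u, v]) $ 2]"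
    if "norm u < r" "norm v < r" for u v \<theta>
    using eqv[of "vector [u, v]" \<theta>] inS[of u v] inS[of "cis (real k * \<theta>) * u" "cis (real l * \<theta>) * v"] that
    by (simp add: rotation_mult norm_mult)
  have opn: "open {s::complex. norm (s^m * u) < r \<and> norm (s^n * v) < r}" for m n and u v :: complex
    by (intro open_Collect_conj open_Collect_less continuous_intros)
  have c1: "h (vector [u, v]) $ 1 = A $ 1 $ 1 * u" if "norm u < r" "norm v < r" for u v
  proof (rule weight_component_linear[OF kl(1) _ kl(3) r _ _ _ little that])
    show "1 \<le> k" using kl by simp
    show "(\<lambda>u. h (vector [u, v]) $ 1) holomorphic_on ball 0 r" if "norm v < r" for v
      by (rule holomorphic_on_slice[OF h S(1)]) (use inS that in \<open>auto intro!: holomorphic_intros\<close>)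
    show "(\<lambda>s. h (vector [s^k * u, s^l * v]) $ 1) holomorphic_on {s. norm (s^k * u) < r \<and> norm (s^l * v) < r}"
      for u v
      by (rule holomorphic_on_slice[OF h S(1) opn]) (use inS in \<open>auto intro!: holomorphic_intros\<close>)
  qed (simp_all add: eqv')
  have c2: "h (vector [v, u]) $ 2 = A $ 2 $ 2 * u" if "norm u < r" "norm v < r" for u v
  proof (rule weight_component_linear[where p = "\<lambda>u v. h (vector [v, u]) $ 2" and k = l and l = k
          and b = "A $ 2 $ 1", OF _ _ kl(2) r _ _ _ _ that])
    show "1 \<le> l" "coprime l k" using kl by (auto simp: coprime_commute)
    show "(\<lambda>u. h (vector [v, u]) $ 2) holomorphic_on ball 0 r" if "norm v < r" for v
      by (rule holomorphic_on_slice[OF h S(1)]) (use inS that in \<open>auto intro!: holomorphic_intros\<close>)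
    show "(\<lambda>s. h (vector [s^k * v, s^l * u]) $ 2) holomorphic_on {s. norm (s^l * u) < r \<and> norm (s^k * v) < r}"
      for u v
      by (rule holomorphic_on_slice[OF h S(1) opn]) (use inS in \<open>auto intro!: holomorphic_intros\<close>)
    show "\<exists>s>0. \<forall>u v. norm u < s \<and> norm v < s \<longrightarrow>
      norm (h (vector [v, u]) $ 2 - (A $ 2 $ 2 * u + A $ 2 $ 1 * v)) \<le> \<epsilon> * max (norm u) (norm v)"
      if "\<epsilon> > 0" for \<epsilon>
      using little[OF that, of 2] by (metis (no_types, lifting) max.commute add.commute)
  qed (simp_all add: eqv')
  define B :: "complex^2^2" where "B = vector [vector [A $ 1 $ 1, 0], vector [0, A $ 2 $ 2]]"
  have eq: "h z = B *v z" if "norm z < r" for z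
  proof -
    have "norm (z $ 1) < r" "norm (z $ 2) < r"
      using that Finite_Cartesian_Product.norm_nth_le le_less_trans by blast+
    moreover have z_eq: "vector [z $ 1, z $ 2] = z" by (simp add: vec_eq_iff forall_2)
    ultimately show ?thesis
      using c1[of "z $ 1" "z $ 2", unfolded z_eq] c2[of "z $ 2" "z $ 1", unfolded z_eq]
      by (simp add: vec_eq_iff forall_2 B_def matrix_vector_mult_def sum_2)
  qed
  have "((\<lambda>v. B *v v) has_derivative (\<lambda>v. A *v v)) (at 0)"
    by (rule has_derivative_transform_within_open[OF dh, of "ball 0 r"]) (use eq r in auto)
  then have "(\<lambda>v. B *v v) = (\<lambda>v. A *v v)"
    using has_derivative_unique has_derivative_matrix by blast
  then show ?thesis using eq r by (metis (no_types))
qed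

text \<open>Along a line \<open>s \<mapsto> h (s p)\<close> the \<open>n\<close>-th Taylor coefficient is multiplied by both \<open>\<mu>^n\<close> and \<open>\<mu>\<close>, so only
  the linear one survives.\<close>

theorem scalar_equivariant_linear:
  assumes lam: "norm \<mu> = 1" "\<And>n. n > 0 \<Longrightarrow> \<mu> ^ n \<noteq> 1"
    and h: "h holomorphic2_on S" and S: "open S" "0 \<in> S"
    and dh: "(h has_derivative (\<lambda>v. A *v v)) (at 0)"
    and eqv: "\<And>z. z \<in> S \<Longrightarrow> \<mu> *s z \<in> S \<Longrightarrow> h (\<mu> *s z) = \<mu> *s h z"
  shows "\<exists>e>0. \<forall>z. norm z < e \<longrightarrow> h z = A *v z"
proof -
  obtain r where r: "r > 0" "ball 0 r \<subseteq> S" using S open_contains_ball by blast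
  have "h p $ i = (A *v p) $ i" if p: "norm p < r" for p i
  proof -
    define R where "R = (if p = 0 then 2 else r / norm p)"
    have R: "R > 1" using p r by (auto simp: R_def)
    have im: "s *s p \<in> S" if "norm s < R" for s
    proof -
      have "norm s * norm p < r" using that r by (auto simp: R_def field_simps split: if_splits)
      then show ?thesis using r by (auto simp: norm_vec_smult)
    qed
    define \<phi> where "\<phi> = (\<lambda>s. h (s *s p) $ i - s * (A *v p) $ i)"
    have hol: "\<phi> holomorphic_on ball 0 R"
      unfolding \<phi>_def
      by (intro holomorphic_intros holomorphic_on_slice[OF h S(1)])
         (use im in \<open>auto intro!: holomorphic_intros\<close>)
    have eq: "\<phi> (\<mu> * s) = \<mu> * \<phi> s" if "s \<in> ball 0 R" for s
    proof -
      have "s *s p \<in> S" "\<mu> *s (s *s p) \<in> S"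
        using im[of s] im[of "\<mu> * s"] that lam by (auto simp: norm_mult vector_smult_assoc)
      from eqv[OF this] show ?thesis
        by (simp add: \<phi>_def vector_smult_assoc algebra_simps)
    qed
    have "(\<phi> has_field_derivative (A *v p) $ i - 1 * (A *v p) $ i) (at 0)"
      unfolding \<phi>_def by (intro DERIV_diff has_field_derivative_slice dh DERIV_cmult_right DERIV_ident)
    then have d1: "deriv \<phi> 0 = 0" using DERIV_imp_deriv by fastforce
    have ev: "\<forall>\<^sub>F s in nhds 0. \<phi> (\<mu> * s) = \<mu> * \<phi> s"
      by (rule eventually_mono[OF eventually_nhds_in_open[of "ball 0 R"]]) (use R eq in auto)
    have "(deriv ^^ n) \<phi> 0 = 0" for n
    proof (cases "n = 1")
      case False
      have "\<mu> ^ n * (deriv ^^ n) \<phi> (\<mu> * 0) = (deriv ^^ n) (\<lambda>s. \<phi> (\<mu> * s)) 0"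
        by (rule higher_deriv_compose_linear[symmetric, OF hol, of "ball 0 R"])
           (use R lam in \<open>auto simp: norm_mult\<close>)
      also have "\<dots> = (deriv ^^ n) (\<lambda>s. \<mu> * \<phi> s) 0"
        by (rule higher_deriv_cong_ev[OF ev refl])
      also have "\<dots> = \<mu> * (deriv ^^ n) \<phi> 0"
        by (rule higher_deriv_cmult[OF hol]) (use R in auto)
      finally have "(\<mu> ^ n - \<mu>) * (deriv ^^ n) \<phi> 0 = 0" by (simp add: algebra_simps)
      moreover have "\<mu> ^ n \<noteq> \<mu>"
      proof (cases n)
        case 0 then show ?thesis using lam(2)[of 1] by simp
      next
        case (Suc m)
        then have "m > 0" using False by simp
        then show ?thesis using lam(2)[of m] lam(1) Suc by auto
      qed
      ultimately show ?thesis by simp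
    qed (simp add: d1)
    then have "\<phi> 1 = 0" using holomorphic_fun_eq_0_on_ball[OF hol, of 1] R by simp
    then show ?thesis by (simp add: \<phi>_def)
  qed
  then show ?thesis using r by (auto simp: vec_eq_iff)
qed

section \<open>Words of prescribed trace in two rotation groups\<close>

text \<open>The equation holds along the curve \<open>y = \<pi>/2 + arctan (c tan x)\<close>. If the phase \<open>(p x + q y) / \<pi>\<close> took
  only rational values there, it would be constant by continuity and its derivative would vanish. This derivative is,
  up to a positive factor, affine in \<open>tan\<^sup>2 x\<close> with coefficients \<open>c (p c + q)\<close> and \<open>p + q c\<close>; both can vanish
  only if \<open>p (1 - c\<^sup>2) = 0\<close>.\<close>

lemma irrational_phase_on_trace_zero_curve:
  fixes p q c :: real
  assumes p: "p \<noteq> 0" and c: "\<bar>c\<bar> < 1"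
  obtains x y where "cos x * cos y + c * sin x * sin y = 0" "(p * x + q * y) / pi \<notin> \<rat>"
proof -
  define Y where "Y = (\<lambda>x. pi/2 + arctan (c * tan x))"
  define \<Phi> where "\<Phi> = (\<lambda>x. (p * x + q * Y x) / pi)"
  have cos0: "cos x > 0" if "x \<in> {0..1}" for x :: real
    using that pi_gt3 by (intro cos_gt_zero_pi) auto
  have curve: "cos x * cos (Y x) + c * sin x * sin (Y x) = 0" if "x \<in> {0..1}" for x
  proof -
    define a where "a = arctan (c * tan x)"
    have ca: "cos a > 0" unfolding a_def using arctan_bounded by (intro cos_gt_zero_pi) auto
    have "tan a = c * tan x" by (simp add: a_def tan_arctan)
    then have "sin a * cos x = c * sin x * cos a"
      using ca cos0[OF that] by (simp add: tan_def field_simps)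
    then show ?thesis by (simp add: Y_def a_def[symmetric] cos_add sin_add algebra_simps)
  qed
  have d: "(\<Phi> has_real_derivative (p + q * (c * (1 + (tan x)\<^sup>2) / (1 + c\<^sup>2 * (tan x)\<^sup>2))) / pi) (at x)"
    if "x \<in> {0..1}" for x
  proof -
    have "cos x \<noteq> 0" using cos0[OF that] by simp
    then have sec: "inverse ((cos x)\<^sup>2) = 1 + (tan x)\<^sup>2" by (simp add: tan_sec power_inverse)
    have "((\<lambda>x. c * tan x) has_real_derivative c * (1 + (tan x)\<^sup>2)) (at x)"
      using DERIV_cmult[OF DERIV_tan[OF \<open>cos x \<noteq> 0\<close>], of c] unfolding sec .
    then have "(Y has_real_derivative (0 + inverse (1 + (c * tan x)\<^sup>2) * (c * (1 + (tan x)\<^sup>2)))) (at x)"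
      unfolding Y_def by (intro DERIV_add DERIV_const DERIV_chain2[OF DERIV_arctan])
    then have "(\<Phi> has_real_derivative
        (p * 1 + q * (0 + inverse (1 + (c * tan x)\<^sup>2) * (c * (1 + (tan x)\<^sup>2)))) / pi) (at x)"
      unfolding \<Phi>_def by (intro DERIV_cdivide DERIV_add DERIV_cmult DERIV_ident)
    then show ?thesis by (simp add: power_mult_distrib divide_inverse mult_ac)
  qed
  have "\<exists>x\<in>{0..1}. \<Phi> x \<notin> \<rat>"
  proof (rule ccontr)
    assume "\<not> ?thesis"
    then have sub: "\<Phi> ` {0..1} \<subseteq> \<rat>" by auto
    have "continuous_on {0..1} \<Phi>"
      using d by (meson DERIV_isCont continuous_at_imp_continuous_on)
    then have conn: "connected (\<Phi> ` {0..1})" by (intro connected_continuous_image) auto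
    have "countable (\<Phi> ` {0..1})" using sub countable_rat countable_subset by blast
    then have const: "\<Phi> x = \<Phi> 0" if "x \<in> {0..1}" for x
      using connected_uncountable[OF conn, of "\<Phi> x" "\<Phi> 0"] that by auto
    have stationary: "p * (1 + c\<^sup>2 * (tan x)\<^sup>2) + q * c * (1 + (tan x)\<^sup>2) = 0" if x: "0 < x" "x < 1" for x
    proof -
      have "(p + q * (c * (1 + (tan x)\<^sup>2) / (1 + c\<^sup>2 * (tan x)\<^sup>2))) / pi = 0"
      proof (rule DERIV_local_const[OF d])
        show "\<forall>y. \<bar>x - y\<bar> < min x (1 - x) \<longrightarrow> \<Phi> x = \<Phi> y"
        proof (intro allI impI)
          fix y assume "\<bar>x - y\<bar> < min x (1 - x)"
          then have "y \<in> {0..1}" by auto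
          then show "\<Phi> x = \<Phi> y" using const[of x] const[of y] x by simp
        qed
      qed (use x in auto)
      then have eq: "p + q * (c * (1 + (tan x)\<^sup>2) / (1 + c\<^sup>2 * (tan x)\<^sup>2)) = 0" by simp
      have "1 + c\<^sup>2 * (tan x)\<^sup>2 > 0" by (intro add_pos_nonneg) auto
      then show ?thesis using eq by (simp add: field_simps)
    qed
    \<comment> \<open>Two values of \<open>tan\<^sup>2 x\<close>, namely \<open>1\<close> and \<open>1/3\<close>, suffice to eliminate \<open>q c\<close>.\<close>
    have "pi/4 < 1" "pi/6 < 1" using pi_less_4 by auto
    from stationary[OF _ this(1)] stationary[OF _ this(2)]
    have "p * (1 + c\<^sup>2) + 2 * (q * c) = 0" "p * (1 + c\<^sup>2 / 3) + q * c * (4/3) = 0"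
      by (simp_all add: tan_45 tan_30 power_divide)
    then have "p + p * c\<^sup>2 + 2 * (q * c) = 0" "3 * p + p * c\<^sup>2 + 4 * (q * c) = 0"
      by (simp_all add: distrib_left)
    then have "p - p * c\<^sup>2 = 0" by linarith
    then have "p * (1 - c\<^sup>2) = 0" by (simp only: right_diff_distrib mult_1_right)
    moreover have "c\<^sup>2 < 1" using c by (simp add: abs_square_less_1)
    ultimately show False using p by simp
  qed
  then obtain x where "x \<in> {0..1}" "\<Phi> x \<notin> \<rat>" by blast
  then show ?thesis using that[of x "Y x"] curve by (simp add: \<Phi>_def)
qed

section \<open>Automorphisms fixing the origin\<close>

lemma matrix_mult_2:
  fixes A B :: "complex^2^2"
  shows "(A ** B) $ i $ j = A$i$1 * B$1$j + A$i$2 * B$2$j"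
  by (simp add: matrix_matrix_mult_def sum_2)

text \<open>The derivative at the origin is part of the predicate, and invertibility is expressed by an inverse
  on \<open>D\<close>, so that closure under composition needs no choice of inverse functions.\<close>

definition origin_automorphism :: "(complex^2) set \<Rightarrow> (complex^2 \<Rightarrow> complex^2) \<Rightarrow> complex^2^2 \<Rightarrow> bool" where
  "origin_automorphism D g A \<longleftrightarrow>
     g holomorphic2_on D \<and> g ` D \<subseteq> D \<and> g 0 = 0 \<and> (g has_derivative (\<lambda>v. A *v v)) (at 0) \<and>
     (\<exists>g'. g' holomorphic2_on D \<and> g' ` D \<subseteq> D \<and> (\<forall>z\<in>D. g' (g z) = z \<and> g (g' z) = z))"

lemma origin_automorphism_compose:
  assumes D: "open D" "0 \<in> D" and g: "origin_automorphism D g A" and h: "origin_automorphism D h B"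
  shows "origin_automorphism D (\<lambda>z. g (h z)) (A ** B)"
proof -
  obtain g' where g': "g' holomorphic2_on D" "g' ` D \<subseteq> D" "\<And>z. z \<in> D \<Longrightarrow> g' (g z) = z \<and> g (g' z) = z"
    using g unfolding origin_automorphism_def by blast
  obtain h' where h': "h' holomorphic2_on D" "h' ` D \<subseteq> D" "\<And>z. z \<in> D \<Longrightarrow> h' (h z) = z \<and> h (h' z) = z"
    using h unfolding origin_automorphism_def by blast
  have gh: "g holomorphic2_on D" "g ` D \<subseteq> D" "g 0 = 0" "(g has_derivative (\<lambda>v. A *v v)) (at 0)"
    "h holomorphic2_on D" "h ` D \<subseteq> D" "h 0 = 0" "(h has_derivative (\<lambda>v. B *v v)) (at 0)"
    using g h unfolding origin_automorphism_def by blast+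
  have "((\<lambda>z. g (h z)) has_derivative (\<lambda>v. A *v (B *v v))) (at 0)"
    using has_derivative_compose[OF gh(8), of g] gh(3,4,7) by simp
  then have "((\<lambda>z. g (h z)) has_derivative (\<lambda>v. (A ** B) *v v)) (at 0)"
    by (simp add: matrix_vector_mul_assoc)
  moreover have "(\<lambda>z. g (h z)) holomorphic2_on D"
    by (rule holomorphic2_on_compose[OF gh(5,1) D(1) D(1) gh(6)])
  moreover have "(\<lambda>z. h' (g' z)) holomorphic2_on D"
    by (rule holomorphic2_on_compose[OF g'(1) h'(1) D(1) D(1) g'(2)])
  moreover have "\<forall>z\<in>D. h' (g' (g (h z))) = z \<and> g (h (h' (g' z))) = z"
    using g'(2,3) h'(2,3) gh(2,6) by (simp add: image_subset_iff)
  ultimately show ?thesis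
    unfolding origin_automorphism_def using gh(2,3,6,7) g'(2) h'(2)
    by (intro conjI exI[of _ "\<lambda>z. h' (g' z)"]) (auto simp: image_subset_iff)
qed

locale bounded_domain =
  fixes D :: "(complex^2) set"
  assumes D: "open D" "connected D" "bounded D" "0 \<in> D"
begin

lemma linear_on_domain:
  assumes "h holomorphic2_on D" "e > 0" "\<And>z. norm z < e \<Longrightarrow> h z = A *v z" "z \<in> D"
  shows "h z = A *v z"
  by (rule holomorphic2_identity[OF assms(1) holomorphic2_on_matrix D(1,2,4) assms(2) _ assms(4)])
     (use assms(3) in simp)

text \<open>Both compositions are automorphisms with the same derivative at the origin.\<close>

lemma origin_automorphisms_commute:
  assumes g: "origin_automorphism D g A" and h: "origin_automorphism D h B"
    and AB: "A ** B = B ** A" and z: "z \<in> D"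
  shows "g (h z) = h (g z)"
proof -
  have gh: "origin_automorphism D (\<lambda>z. g (h z)) (A ** B)"
    by (rule origin_automorphism_compose[OF D(1,4) g h])
  have hg: "origin_automorphism D (\<lambda>z. h (g z)) (A ** B)"
    unfolding AB by (rule origin_automorphism_compose[OF D(1,4) h g])
  obtain u' where u': "u' holomorphic2_on D" "u' ` D \<subseteq> D"
    "\<And>z. z \<in> D \<Longrightarrow> u' (g (h z)) = z" "\<And>z. z \<in> D \<Longrightarrow> g (h (u' z)) = z"
    using gh unfolding origin_automorphism_def by blast
  show ?thesis
    by (rule automorphism_determined_by_derivative[OF D, where u = "\<lambda>z. g (h z)"
          and v = "\<lambda>z. h (g z)", OF _ _ _ _ u'])
       (use gh hg z in \<open>auto simp: origin_automorphism_def\<close>)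
qed

lemma origin_automorphism_power_bounded:
  "origin_automorphism D g A \<Longrightarrow> power_bounded A"
  unfolding origin_automorphism_def using power_bounded_self_map_derivative D by blast

end

text \<open>Normal quasi-circular domains with weight divided by the greatest common divisor. Either weight may
  be the larger one.\<close>

locale quasi_circular_domain = bounded_domain +
  fixes k l :: nat
  assumes weights: "coprime k l" "2 \<le> k" "2 \<le> l"
    and rotation_invariant: "z \<in> D \<Longrightarrow> rotation k l \<theta> *v z \<in> D"
begin

lemma weights_distinct: "real k - real l \<noteq> 0"
  using weights by auto

lemma origin_automorphism_rotation:
  "origin_automorphism D (\<lambda>z. rotation k l \<theta> *v z) (rotation k l \<theta>)"
  unfolding origin_automorphism_def
  using rotation_invariant has_derivative_matrix holomorphic2_on_matrix rotation_inverse
  by (intro conjI exI[of _ "\<lambda>z. rotation k l (-\<theta>) *v z"]) (auto simp: rotation_inverse)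

lemma diagonal_derivative_linear:
  assumes g: "origin_automorphism D g A" and A: "A$1$2 = 0" "A$2$1 = 0" and z: "z \<in> D"
  shows "g z = A *v z"
proof -
  have "A ** rotation k l \<theta> = rotation k l \<theta> ** A" for \<theta>
    by (simp add: vec_eq_iff forall_2 matrix_mult_2 rotation_nth A mult.commute)
  then have eqv: "g (rotation k l \<theta> *v z) = rotation k l \<theta> *v g z" if "z \<in> D" for \<theta> z
    using origin_automorphisms_commute[OF g origin_automorphism_rotation] that by blast
  obtain e where "e > 0" "\<And>z. norm z < e \<Longrightarrow> g z = A *v z"
    using rotation_equivariant_linear[OF weights _ D(1,4), of g A] g eqv
    unfolding origin_automorphism_def by blast
  then show ?thesis using linear_on_domain g z unfolding origin_automorphism_def by blast
qed

text \<open>The automorphism \<open>g\<close> has diagonal derivative, hence is multiplication by \<open>\<mu>\<close> on \<open>D\<close>, and it commutes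
  with \<open>h\<close> because scalar matrices are central.\<close>

lemma linear_if_scalar_automorphism:
  assumes g: "origin_automorphism D g (mat \<mu>)" and \<mu>: "norm \<mu> = 1" "\<And>n. n > 0 \<Longrightarrow> \<mu> ^ n \<noteq> 1"
    and h: "origin_automorphism D h B" and z: "z \<in> D"
  shows "h z = B *v z"
proof -
  have mat: "mat \<mu> *v v = \<mu> *s v" for v :: "complex^2"
    by (simp add: vec_eq_iff forall_2 matrix_vector_mult_def sum_2 mat_def)
  have g_eq: "g v = \<mu> *s v" if "v \<in> D" for v
    using diagonal_derivative_linear[OF g _ _ that] by (simp add: mat) (simp add: mat_def)
  have "mat \<mu> ** B = B ** mat \<mu>"
    by (simp add: vec_eq_iff forall_2 matrix_mult_2 mat_def mult.commute)
  then have "g (h v) = h (g v)" if "v \<in> D" for v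
    by (rule origin_automorphisms_commute[OF g h _ that])
  moreover have "h v \<in> D" if "v \<in> D" for v using h that unfolding origin_automorphism_def by blast
  ultimately have eqv: "h (\<mu> *s v) = \<mu> *s h v" if "v \<in> D" for v using g_eq that by metis
  obtain e where "e > 0" "\<And>z. norm z < e \<Longrightarrow> h z = B *v z"
    using scalar_equivariant_linear[OF \<mu> _ D(1,4), of h B] h eqv
    unfolding origin_automorphism_def by blast
  then show ?thesis using linear_on_domain h z unfolding origin_automorphism_def by blast
qed

text \<open>The matrices \<open>B \<tau> = A' R'(\<tau>) A\<close> have diagonal entries \<open>\<alpha> \<mu>\<^sub>1 + \<beta> \<mu>\<^sub>2\<close> and \<open>\<beta> \<mu>\<^sub>1 + \<alpha> \<mu>\<^sub>2\<close>, where \<open>\<mu>\<^sub>1\<close>, \<open>\<mu>\<^sub>2\<close>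
  are those of \<open>R'(\<tau>)\<close> and \<open>\<alpha> + \<beta> = 1\<close>; the off-diagonal entries are constant multiples of
  \<open>\<mu>\<^sub>1 - \<mu>\<^sub>2\<close>. The parameter that decides between commuting and noncommuting rotation groups is
  \<open>c = \<beta> - \<alpha>\<close>.\<close>

lemma conjugate_rotations_linear:
  assumes n: "n\<^sub>1 \<noteq> (n\<^sub>2 :: nat)" and inv: "A' ** A = mat 1" "A ** A' = mat 1"
    and \<phi>: "\<And>\<tau>. origin_automorphism D (\<phi> \<tau>) (A' ** (rotation n\<^sub>1 n\<^sub>2 \<tau> ** A))" and z: "z \<in> D"
  shows "\<phi> \<tau> z = (A' ** (rotation n\<^sub>1 n\<^sub>2 \<tau> ** A)) *v z"
proof -
  define B where "B = (\<lambda>\<tau>. A' ** (rotation n\<^sub>1 n\<^sub>2 \<tau> ** A))"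
  define \<alpha> where "\<alpha> = A'$1$1 * A$1$1"
  define \<beta> where "\<beta> = A'$1$2 * A$2$1"
  have i1: "A'$1$1 * A$1$1 + A'$1$2 * A$2$1 = 1" "A'$1$1 * A$1$2 + A'$1$2 * A$2$2 = 0"
    "A'$2$1 * A$1$1 + A'$2$2 * A$2$1 = 0" "A'$2$1 * A$1$2 + A'$2$2 * A$2$2 = 1"
    using inv(1) by (simp_all add: vec_eq_iff forall_2 matrix_mult_2 mat_def)
  have i2: "A$1$1 * A'$1$1 + A$1$2 * A'$2$1 = 1"
    using inv(2) by (simp_all add: vec_eq_iff forall_2 matrix_mult_2 mat_def)
  have sum: "\<alpha> + \<beta> = 1" using i1 by (simp add: \<alpha>_def \<beta>_def)
  have \<beta>': "A'$2$1 * A$1$2 = \<beta>"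
    using i1(1) i2 by (simp add: \<beta>_def algebra_simps) (metis add_left_imp_eq)
  have \<alpha>': "A'$2$2 * A$2$2 = \<alpha>" using i1(4) \<beta>' sum by (metis add.commute add_left_imp_eq)
  have o1: "A'$1$2 * A$2$2 = - (A'$1$1 * A$1$2)" using i1(2) by (simp add: eq_neg_iff_add_eq_0 add.commute)
  have o2: "A'$2$2 * A$2$1 = - (A'$2$1 * A$1$1)" using i1(3) by (simp add: eq_neg_iff_add_eq_0 add.commute)
  have B_nth: "B \<tau> $ i $ j = A'$i$1 * A$1$j * cis (real n\<^sub>1 * \<tau>) + A'$i$2 * A$2$j * cis (real n\<^sub>2 * \<tau>)" for \<tau> i j
    by (simp add: B_def matrix_mult_2 rotation_nth mult_ac)
  have B11: "B \<tau> $1$1 = \<alpha> * cis (real n\<^sub>1 * \<tau>) + \<beta> * cis (real n\<^sub>2 * \<tau>)"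
    and B22: "B \<tau> $2$2 = \<beta> * cis (real n\<^sub>1 * \<tau>) + \<alpha> * cis (real n\<^sub>2 * \<tau>)"
    and B12: "B \<tau> $1$2 = A'$1$1 * A$1$2 * (cis (real n\<^sub>1 * \<tau>) - cis (real n\<^sub>2 * \<tau>))"
    and B21: "B \<tau> $2$1 = A'$2$1 * A$1$1 * (cis (real n\<^sub>1 * \<tau>) - cis (real n\<^sub>2 * \<tau>))" for \<tau>
    unfolding B_nth \<alpha>' \<beta>' o1 o2 by (simp_all add: \<alpha>_def \<beta>_def algebra_simps)
  have detB: "det (B \<tau>) = cis (real n\<^sub>1 * \<tau>) * cis (real n\<^sub>2 * \<tau>)" for \<tau>
  proof -
    have "det A' * det A = 1" using inv(1) det_mul[of A' A] by (simp add: det_I)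
    then show ?thesis unfolding B_def by (simp add: det_mul det_2[of "rotation _ _ _"] rotation_nth)
  qed
  define K where "K = real k - real l"
  define N where "N = real n\<^sub>1 - real n\<^sub>2"
  define p where "p = (real k + real l) / K"
  define q where "q = (real n\<^sub>1 + real n\<^sub>2) / N"
  have K: "K \<noteq> 0" using weights_distinct by (simp add: K_def)
  have N: "N \<noteq> 0" using n by (simp add: N_def)
  have angles: "real k * (2 * x / K) = p * x + x" "real l * (2 * x / K) = p * x - x"
    "real n\<^sub>1 * (2 * x / N) = q * x + x" "real n\<^sub>2 * (2 * x / N) = q * x - x" for x
    using K N by (simp_all add: p_def q_def field_simps) (simp_all add: K_def N_def algebra_simps)
  \<comment> \<open>With this choice of parameters the rotations are scalars of phase \<open>p x\<close> and \<open>q y\<close> times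
    \<open>diag(e^(i x), e^(- i x))\<close> and \<open>diag(e^(i y), e^(- i y))\<close>, which have determinant \<open>1\<close>.\<close>
  define M where "M = (\<lambda>x y. rotation k l (2 * x / K) ** B (2 * y / N))"
  have autM: "origin_automorphism D (\<lambda>z. rotation k l (2 * x / K) *v \<phi> (2 * y / N) z) (M x y)" for x y
    unfolding M_def B_def
    by (rule origin_automorphism_compose[OF D(1,4) origin_automorphism_rotation \<phi>])
  have detM: "det (M x y) = (cis (p * x + q * y))\<^sup>2" for x y
  proof -
    have "det (M x y) = cis (p*x+x) * cis (p*x-x) * (cis (q*y+y) * cis (q*y-y))"
      unfolding M_def det_mul detB det_2[of "rotation _ _ _"] rotation_nth angles by simp
    then show ?thesis by (simp add: power2_eq_square cis_mult algebra_simps)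
  qed
  have trM: "M x y $1$1 + M x y $2$2
      = 2 * (of_real (cos x * cos y) + (\<beta> - \<alpha>) * of_real (sin x * sin y)) * cis (p * x + q * y)" for x y
  proof -
    have c: "cis (p*x+x) = cis (p*x) * cis x" "cis (p*x-x) = cis (p*x) * cnj (cis x)"
      "cis (q*y+y) = cis (q*y) * cis y" "cis (q*y-y) = cis (q*y) * cnj (cis y)"
      by (simp_all add: cis_mult cis_cnj)
    have re: "cis a * cis b + cnj (cis a) * cnj (cis b) = 2 * of_real (cos a * cos b) - 2 * of_real (sin a * sin b)"
      "cis a * cnj (cis b) + cnj (cis a) * cis b = 2 * of_real (cos a * cos b) + 2 * of_real (sin a * sin b)" for a b
      by (simp_all add: complex_eq_iff)
    have "M x y $1$1 + M x y $2$2 = (\<alpha> * (cis x * cis y + cnj (cis x) * cnj (cis y))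
        + \<beta> * (cis x * cnj (cis y) + cnj (cis x) * cis y)) * (cis (p*x) * cis (q*y))"
      unfolding M_def matrix_mult_2 rotation_nth B11 B22 angles c by (simp add: algebra_simps)
    also have "\<dots> = ((\<alpha> + \<beta>) * (2 * of_real (cos x * cos y)) + (\<beta> - \<alpha>) * (2 * of_real (sin x * sin y)))
        * cis (p * x + q * y)"
      unfolding re unfolding cis_mult by (simp add: algebra_simps)
    finally show ?thesis by (simp add: sum algebra_simps)
  qed
  have cis1: "norm (cis t) = 1" for t by simp
  \<comment> \<open>At this point the first summand of the trace vanishes and the factor of \<open>\<beta> - \<alpha>\<close> is \<open>1\<close>.\<close>
  obtain c :: real where c: "M (pi/2) (pi/2) $1$1 + M (pi/2) (pi/2) $2$2 = 2 * of_real c * cis (p * (pi/2) + q * (pi/2))"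
    "\<bar>c\<bar> \<le> 1" "\<bar>c\<bar> = 1 \<Longrightarrow> M (pi/2) (pi/2) $1$2 = 0 \<and> M (pi/2) (pi/2) $2$1 = 0"
    using power_bounded_trace[OF origin_automorphism_power_bounded[OF autM] detM cis1] by blast
  have "2 * (\<beta> - \<alpha>) = 2 * of_real c" using c(1) unfolding trM by simp
  then have c_eq: "\<beta> - \<alpha> = of_real c" by (metis mult_left_cancel zero_neq_numeral)
  show ?thesis
  proof (cases "\<bar>c\<bar> = 1")
    case True
    have "cis (q * (pi/2) + pi/2) - cis (q * (pi/2) - pi/2) = 2 * \<i> * cis (q * (pi/2))"
      by (simp add: complex_eq_iff cos_add sin_add cos_diff sin_diff)
    then have "cis (q * (pi/2) + pi/2) - cis (q * (pi/2) - pi/2) \<noteq> 0" by simp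
    then have "A'$1$1 * A$1$2 = 0" "A'$2$1 * A$1$1 = 0"
      using c(3)[OF True] unfolding M_def matrix_mult_2 rotation_nth B12 B21 angles by auto
    then have "B \<tau> $1$2 = 0" "B \<tau> $2$1 = 0" by (auto simp: B12 B21)
    then show ?thesis using diagonal_derivative_linear[OF \<phi> _ _ z] unfolding B_def by blast
  next
    case False
    have "p \<noteq> 0" using K weights by (simp add: p_def)
    then obtain x y where xy: "cos x * cos y + c * sin x * sin y = 0" "(p * x + q * y) / pi \<notin> \<rat>"
      using irrational_phase_on_trace_zero_curve[of p c q] c(2) False by (metis less_le)
    define w where "w = p * x + q * y"
    define \<mu> where "\<mu> = - ((cis w)\<^sup>2)"
    have "of_real (cos x * cos y) + (\<beta> - \<alpha>) * of_real (sin x * sin y) = of_real (cos x * cos y + c * sin x * sin y)"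
      unfolding c_eq by simp
    then have tr: "M x y $2$2 = - M x y $1$1" using trM[of x y] xy(1) by (simp add: add_eq_0_iff)
    have det: "M x y $1$1 * M x y $2$2 - M x y $1$2 * M x y $2$1 = - \<mu>"
      using detM[of x y] by (simp add: det_2 \<mu>_def w_def)
    \<comment> \<open>The Cayley-Hamilton theorem for trace zero.\<close>
    have "M x y ** M x y = mat \<mu>"
      using det by (simp add: vec_eq_iff forall_2 matrix_mult_2 mat_def tr algebra_simps)
    moreover have "\<mu> ^ n \<noteq> 1" if "n > 0" for n
    proof
      assume "\<mu> ^ n = 1"
      moreover have "\<mu> = cis (2 * w + pi)" by (simp add: \<mu>_def power2_eq_square cis_mult complex_eq_iff)
      ultimately have "cis (real n * (2 * w + pi)) = 1" by (simp add: Complex.DeMoivre)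
      then have "cos (real n * (2 * w + pi)) = 1" by (metis cis.sel(1) one_complex.sel(1))
      then obtain j :: int where "real n * (2 * w + pi) = of_int j * 2 * pi"
        by (auto simp: cos_one_2pi_int)
      then have "w / pi = (2 * of_int j / real n - 1) / 2"
        using that by (simp add: field_simps)
      also have "\<dots> \<in> \<rat>" by simp
      finally show False using xy(2) by (simp add: w_def)
    qed
    moreover have "norm \<mu> = 1" by (simp add: \<mu>_def norm_power)
    ultimately show ?thesis
      using linear_if_scalar_automorphism[OF _ _ _ \<phi> z]
        origin_automorphism_compose[OF D(1,4) autM[of x y] autM[of x y]] by metis
  qed
qed

end

section \<open>Linearity of biholomorphisms\<close>

text \<open>The rotation by \<open>\<theta>\<close> for the divided weight is the rotation by \<open>\<theta> / g\<close> for the given one.\<close>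

lemma normal_quasi_circular_domain:
  assumes "normal_quasi_circular m\<^sub>1 m\<^sub>2 D"
  obtains k l where "quasi_circular_domain D k l"
proof -
  define g where "g = gcd m\<^sub>1 m\<^sub>2"
  define k where "k = m\<^sub>1 div g"
  define l where "l = m\<^sub>2 div g"
  note qc = assms[unfolded normal_quasi_circular_def quasi_circular_def]
  have g: "g > 0" "m\<^sub>1 = k * g" "m\<^sub>2 = l * g" using qc by (auto simp: g_def k_def l_def)
  have "rotation k l \<theta> *v z \<in> D" if "z \<in> D" for z \<theta>
  proof -
    have "vector [cis (real m\<^sub>1 * (\<theta> / real g)) * z $ 1, cis (real m\<^sub>2 * (\<theta> / real g)) * z $ 2] \<in> D"
      using qc that by blast
    moreover have "real m\<^sub>1 * (\<theta> / real g) = real k * \<theta>" "real m\<^sub>2 * (\<theta> / real g) = real l * \<theta>"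
      using g(1) by (simp_all add: g(2,3))
    ultimately show ?thesis by (simp only: rotation_mult)
  qed
  moreover have "coprime k l"
    unfolding k_def l_def g_def using qc by (intro div_gcd_coprime) auto
  ultimately have "quasi_circular_domain D k l"
    using qc by unfold_locales (auto simp: k_def l_def g_def)
  then show ?thesis using that by blast
qed

text \<open>Once the conjugates of the rotations of \<open>D'\<close> under \<open>f\<close> are linear, \<open>f \<circ> A'\<close> is equivariant with respect
  to the rotations of \<open>D'\<close> on source and target and has derivative \<open>1\<close> at the origin. It is therefore
  the identity near the origin, and the identity theorem gives \<open>f = A\<close> on \<open>D\<close>.\<close>

lemma biholomorphism_linear:
  assumes "quasi_circular_domain D k l" "quasi_circular_domain D' n\<^sub>1 n\<^sub>2"
    and f: "biholomorphism D D' f" "f 0 = 0"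
  shows "\<exists>A. \<forall>z\<in>D. f z = A *v z"
proof -
  interpret D: quasi_circular_domain D k l by fact
  interpret D': quasi_circular_domain D' n\<^sub>1 n\<^sub>2 by fact
  define f' where "f' = inv_into D f"
  have bij: "bij_betw f D D'" and hf: "f holomorphic2_on D" and hf': "f' holomorphic2_on D'"
    using f by (auto simp: biholomorphism_def f'_def)
  have ff: "f' (f z) = z" "f z \<in> D'" if "z \<in> D" for z
    using bij that unfolding f'_def by (auto simp: bij_betw_inv_into_left bij_betwE)
  have ff': "f (f' z) = z" "f' z \<in> D" if "z \<in> D'" for z
    using bij that unfolding f'_def
    by (auto simp: bij_betw_inv_into_right bij_betw_def inv_into_into)
  have f'0: "f' 0 = 0" using ff(1)[OF D.D(4)] f(2) by simp
  obtain A where A: "(f has_derivative (\<lambda>v. A *v v)) (at 0)"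
    using holomorphic2_on_derivative_at[OF hf D.D(1,4)] by metis
  obtain A' where A': "(f' has_derivative (\<lambda>v. A' *v v)) (at 0)"
    using holomorphic2_on_derivative_at[OF hf' D'.D(1,4)] by metis
  have "((\<lambda>z. f' (f z)) has_derivative (\<lambda>v. A' *v (A *v v))) (at 0)"
    using has_derivative_compose[OF A, of f'] A' f(2) by simp
  then have "((\<lambda>z. z) has_derivative (\<lambda>v. A' *v (A *v v))) (at 0)"
    by (rule has_derivative_transform_within_open[OF _ D.D(1,4)]) (simp add: ff)
  then have "(\<lambda>v. A' *v (A *v v)) = (\<lambda>v. v)"
    using has_derivative_unique has_derivative_ident by blast
  then have AA: "A' ** A = mat 1"
    by (simp add: matrix_eq matrix_vector_mul_assoc[symmetric] fun_eq_iff)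
  then have AA': "A ** A' = mat 1" using matrix_left_right_inverse by blast
  define \<phi> where "\<phi> = (\<lambda>\<tau> z. f' (rotation n\<^sub>1 n\<^sub>2 \<tau> *v f z))"
  have rotD': "rotation n\<^sub>1 n\<^sub>2 \<tau> *v f z \<in> D'" if "z \<in> D" for z \<tau>
    using D'.rotation_invariant ff that by blast
  have \<phi>D: "\<phi> \<tau> ` D \<subseteq> D" for \<tau> using rotD' ff'(2) by (auto simp: \<phi>_def)
  have hol\<phi>: "\<phi> \<tau> holomorphic2_on D" for \<tau>
    unfolding \<phi>_def
  proof (rule holomorphic2_on_compose[OF _ hf' D.D(1) D'.D(1)])
    show "(\<lambda>z. rotation n\<^sub>1 n\<^sub>2 \<tau> *v f z) holomorphic2_on D"
      by (rule holomorphic2_on_compose[OF hf holomorphic2_on_matrix[of _ UNIV] D.D(1)]) auto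
  qed (use rotD' in auto)
  have aut: "origin_automorphism D (\<phi> \<tau>) (A' ** (rotation n\<^sub>1 n\<^sub>2 \<tau> ** A))" for \<tau>
    unfolding origin_automorphism_def
  proof (intro conjI exI[of _ "\<phi> (-\<tau>)"] ballI)
    have "((\<lambda>z. rotation n\<^sub>1 n\<^sub>2 \<tau> *v f z) has_derivative (\<lambda>v. rotation n\<^sub>1 n\<^sub>2 \<tau> *v (A *v v))) (at 0)"
      by (rule has_derivative_compose[OF A has_derivative_matrix])
    from has_derivative_compose[OF this, of f' "\<lambda>v. A' *v v"]
    show "(\<phi> \<tau> has_derivative (\<lambda>v. (A' ** (rotation n\<^sub>1 n\<^sub>2 \<tau> ** A)) *v v)) (at 0)"
      using A' f(2) by (simp add: \<phi>_def matrix_vector_mul_assoc)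
  qed (use hol\<phi> \<phi>D f(2) f'0 ff ff' rotD' in \<open>auto simp: \<phi>_def rotation_inverse\<close>)
  have "n\<^sub>1 \<noteq> n\<^sub>2" using D'.weights_distinct by auto
  note lin = D.conjugate_rotations_linear[OF this AA AA' aut]
  define S where "S = (\<lambda>w. A' *v w) -` D"
  define h where "h = (\<lambda>w. f (A' *v w))"
  have contm: "continuous_on UNIV (\<lambda>w. B *v w)" for B :: "complex^2^2"
    using holomorphic2_on_continuous_on holomorphic2_on_matrix by blast
  have S: "open S" "0 \<in> S" unfolding S_def using contm D.D by (auto intro: open_vimage)
  have "\<exists>e>0. \<forall>w. norm w < e \<longrightarrow> h w = mat 1 *v w"
  proof (rule rotation_equivariant_linear[OF D'.weights _ S])
    show "h holomorphic2_on S"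
      unfolding h_def by (rule holomorphic2_on_compose[OF holomorphic2_on_matrix hf S(1) D.D(1)]) (auto simp: S_def)
    show "(h has_derivative (\<lambda>v. mat 1 *v v)) (at 0)"
      using has_derivative_compose[OF has_derivative_matrix[of A' 0], of f "\<lambda>v. A *v v"] A
      by (simp add: h_def matrix_vector_mul_assoc AA')
    show "h 0 = 0" using f(2) by (simp add: h_def)
    fix \<tau> w assume w: "w \<in> S"
    have z: "A' *v w \<in> D" using w by (simp add: S_def)
    have "f' (rotation n\<^sub>1 n\<^sub>2 \<tau> *v f (A' *v w)) = A' *v (rotation n\<^sub>1 n\<^sub>2 \<tau> *v w)"
      using lin[OF z, of \<tau>] unfolding \<phi>_def
      by (simp add: matrix_vector_mul_assoc matrix_mul_assoc[symmetric] AA')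
    then show "h (rotation n\<^sub>1 n\<^sub>2 \<tau> *v w) = rotation n\<^sub>1 n\<^sub>2 \<tau> *v h w"
      unfolding h_def using ff'(1)[OF rotD'[OF z, of \<tau>]] by simp
  qed
  then obtain e where e: "e > 0" "\<And>w. norm w < e \<Longrightarrow> h w = w" by auto
  have "isCont (\<lambda>z. A *v z) 0" using contm by (simp add: continuous_on_eq_continuous_at)
  then obtain d where d: "d > 0" "\<And>z. norm z < d \<Longrightarrow> norm (A *v z) < e"
    unfolding continuous_at_eps_delta using e(1) by (auto simp: dist_norm)
  have "f z = A *v z" if "norm z < d" for z
    using e(2)[OF d(2)[OF that]] by (simp add: h_def matrix_vector_mul_assoc AA)
  then show ?thesis using D.linear_on_domain[OF hf d(1)] by blast
qed

theorem theorem1p1: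
  fixes D D' :: "(complex^2) set" and m\<^sub>1 m\<^sub>2 n\<^sub>1 n\<^sub>2 :: nat
  assumes "normal_quasi_circular m\<^sub>1 m\<^sub>2 D"
    and "normal_quasi_circular n\<^sub>1 n\<^sub>2 D'"
  shows "(\<forall>f. biholomorphism D D' f \<and> f 0 = 0 \<longrightarrow>
            (\<exists>L. complex_linear L \<and> (\<forall>z\<in>D. f z = L z))) \<and>
         (\<forall>f\<in>Aut D. f 0 = 0 \<longrightarrow>
            (\<exists>L. complex_linear L \<and> (\<forall>z\<in>D. f z = L z)))"
proof -
  obtain k l where D: "quasi_circular_domain D k l"
    using assms(1) normal_quasi_circular_domain by metis
  obtain k' l' where D': "quasi_circular_domain D' k' l'"
    using assms(2) normal_quasi_circular_domain by metis
  show ?thesis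
    using biholomorphism_linear[OF D D'] biholomorphism_linear[OF D D] matrix_vector_mul_linear_gen
    unfolding Aut_def by blast
qed

end
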